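(* Let $\mathcal{O}$ be a bimodule from a category $\mathcal{C}$ to a category $\mathcal{D}$. Consider the following data. <br>- An object is a functor $\mathcal{C}\to\mathcal{D}$. <br>- A loose morphism $f: T_0,\ldots,T_{n-1}\to H$ is an extranatural family of functions $$f_{x_0,\ldots,x_n}:\ \mathcal{O}(x_0,T_0x_1)\times\cdots\times\mathcal{O}(x_{n-1},T_{n-1}x_n)\to\mathcal{O}(x_0,Hx_n)\qquad(x_0,\ldots,x_n\in\mathcal{C}).$$ - A tight morphism $f:\lfloor S,T_0,\ldots,T_{n-1}\to H$ is an extranatural family of functions $$f_{x_0,\ldots,x_n}:\ \mathcal{O}(x_0,T_0x_1)\times\cdots\times\mathcal{O}(x_{n-1},T_{n-1}x_n)\to\mathcal{D}(Sx_0,Hx_n)\qquad(x_0,\ldots,x_n\in\mathcal{C}).$$ - Loosening, identities and composition are the evident ones (written out in the context). <br>These form a hyperlarge left-skew multicategory, and an $\mathcal{O}$-relative monad is precisely a monoid in it. That is, the assignment sending a monoid $(T,m,e)$ to the triple consisting of the object part of $T$, the family $\eta_x:=e_x: x\to Tx$, and the operation $k^*:=m_{x,y}(k): Tx\to Ty$ for $k\in\mathcal{O}(x,Ty)$, is a bijection from monoids in this left-skew multicategory to $\mathcal{O}$-relative monads.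
   Context: **Conventions.** Composition is written in diagrammatic order: $f;g$ is $f$ followed by $g$. One distinguishes sets, classes and collections. A (light) category has a class of objects and hom-sets; notions such as left-skew multicategory are defined below in the light version, and the "hyperlarge" version is obtained by replacing "class" and "set" by "collection". **Bimodule.** A bimodule $\mathcal{O}:\mathcal{C}\to\mathcal{D}$ (profunctor) consists of a set $\mathcal{O}(x,y)$ for each $\mathcal{C}$-object $x$ and $\mathcal{D}$-object $y$, whose elements are called $\mathcal{O}$-morphisms $x\to y$, together with composites $f;g$ ($f$ in $\mathcal{C}$, $g$ in $\mathcal{O}$) and $g;h$ ($g$ in $\mathcal{O}$, $h$ in $\mathcal{D}$) that are unital and associative: $\mathrm{id};g=g=g;\mathrm{id}$, $(f';f);g=f';(f;g)$, $(f;g);h=f;(g;h)$, $g;(h;h')=(g;h);h'$. **Relative monad.** An $\mathcal{O}$-relative monad $(T,\eta,{}^* )$ consists of: for each $x\in\mathcal{C}$, a $\mathcal{D}$-object $Tx$ and an $\mathcal{O}$-morphism $\eta_x:x\to Tx$; for each $x,y\in\mathcal{C}$ and $\mathcal{O}$-morphism $k:x\to Ty$, a $\mathcal{D}$-morphism $k^*:Tx\to Ty$; such that $\eta_x;k^*=k$, $\eta_x^*=\mathrm{id}_{Tx}$, and $k^*;l^*=(k;l^* )^*$ for all $k:x\to Ty$, $l:y\to Tz$. (Here $T$ is given on objects only.) **Left-skew multicategory.** Consists of: a class of objects; for each (possibly empty) object list $\vec a$ and object $x$, a set of loose morphisms $\vec a\to x$; for each nonempty list $\vec a$ and object $x$,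 a set of tight morphisms $\lfloor\vec a\to x$; a loosening operation sending each tight $f:\lfloor\vec a\to x$ to a loose $\acute f:\vec a\to x$; for each $x$ a tight identity $\mathrm{id}_x:\lfloor x\to x$; and compositions $g\circ_x f$ (taken at a specified occurrence of $x$): - (A) $f:\vec b\to x$ loose, $g:\vec a,x,\vec c\to y$ loose, giving a loose $\vec a,\vec b,\vec c\to y$; - (B) $f:\lfloor\vec a\to x$ tight, $g:\lfloor x,\vec b\to y$ tight, giving a tight $\lfloor\vec a,\vec b\to y$; - (C) $f:\vec b\to x$ loose, $g:\lfloor\vec a,x,\vec c\to y$ tight with $\vec a$ nonempty, giving a tight $\lfloor\vec a,\vec b,\vec c\to y$. Axioms: loosening commutes with (B) and (C), i.e. the loosening of a composite is the (A)-composite of the loosenings (a loose argument being left unchanged); composing an identity (loosened where necessary) into any input of $g$ gives $g$, and composing any $f$ into an identity (loosened if $f$ is loose) gives $f$; associativity $h\circ_y(g\circ_x f)=(h\circ_y g)\circ_x f$ for all well-typed combinations of (A), (B), (C); interchange: composing $f$ and $g$ into two distinct inputs of $h$ gives the same result in either order, for all well-typed combinations. **Monoid in a left-skew multicategory.** An object $x$ with a tight $m:\lfloor x,x\to x$ and a loose nullary $e:\ \to x$ such that: composing $e$ into the first input of $\acute m$ gives $\acute{\mathrm{id}}_x$; composing $e$ into the second input of $m$ (by (C)) gives $\mathrm{id}_x$; and composing $m$ into the first input of $m$ (by (B)) equals composing $\acute m$ into the second input of $m$ (by (C)). **Extranaturality** here means, for all $\mathcal{C}$-morphisms $u$ and all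 arguments: - for intermediate $0<i<n$ and $u:x_i\to x_i'$, $f(\ldots,k_{i-1};T_{i-1}u,\,k_i,\ldots)=f(\ldots,k_{i-1},\,u;k_i,\ldots)$; - for $n>0$, naturality in $x_n$: $f(\ldots,k_{n-1};T_{n-1}u)=f(\ldots,k_{n-1});Hu$; - for $n>0$, naturality in $x_0$: $f(u;k_0,\ldots)=u;f(k_0,\ldots)$ in the loose case and $f(u;k_0,\ldots)=Su;f(k_0,\ldots)$ in the tight case; - for $n=0$ and $u:x\to x'$: $u;f_{x'}=f_x;Hu$ in the loose case, $Su;f_{x'}=f_x;Hu$ in the tight case. **Structure of the left-skew multicategory in the claim.** The identity on $S$ is the family $\mathrm{id}_{Sx_0}\in\mathcal{D}(Sx_0,Sx_0)$. The loosening of a tight $f:\lfloor S,T_0,\ldots,T_{n-1}\to H$ sends $(k,k_0,\ldots,k_{n-1})$, with $k\in\mathcal{O}(w,Sx_0)$, to $k;f(k_0,\ldots,k_{n-1})\in\mathcal{O}(w,Hx_n)$. Compositions (A) and (C) are given by substituting the value of $f$ in the relevant argument of $g$. Composition (B) sends $(\vec k,\vec l)$ to $f(\vec k);g(\vec l)$ (composition in $\mathcal{D}$). *)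

theory Defs
  imports Main "HOL-Library.FuncSet"
begin

text \<open>
  Hom-sets are indexed by objects and need not be disjoint, so every operation on morphisms takes
  the objects involved as arguments. Composition is in diagrammatic order:
  \<open>cmp C x y z f g\<close> is \<open>f;g\<close> for \<open>f : x \<rightarrow> y\<close> and \<open>g : y \<rightarrow> z\<close>.
\<close>

record ('o, 'a) category =
  obj :: "'o set"
  arr :: "'o \<Rightarrow> 'o \<Rightarrow> 'a set"
  idt :: "'o \<Rightarrow> 'a"
  cmp :: "'o \<Rightarrow> 'o \<Rightarrow> 'o \<Rightarrow> 'a \<Rightarrow> 'a \<Rightarrow> 'a"

locale category =
  fixes C :: "('o, 'a) category"
  assumes idt_closed: "x \<in> obj C \<Longrightarrow> idt C x \<in> arr C x x"
    and cmp_closed: "\<lbrakk>x \<in> obj C; y \<in> obj C; z \<in> obj C; f \<in> arr C x y; g \<in> arr C y z\<rbrakk>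
      \<Longrightarrow> cmp C x y z f g \<in> arr C x z"
    and idt_cmp: "\<lbrakk>x \<in> obj C; y \<in> obj C; f \<in> arr C x y\<rbrakk> \<Longrightarrow> cmp C x x y (idt C x) f = f"
    and cmp_idt: "\<lbrakk>x \<in> obj C; y \<in> obj C; f \<in> arr C x y\<rbrakk> \<Longrightarrow> cmp C x y y f (idt C y) = f"
    and cmp_assoc: "\<lbrakk>w \<in> obj C; x \<in> obj C; y \<in> obj C; z \<in> obj C;
        f \<in> arr C w x; g \<in> arr C x y; h \<in> arr C y z\<rbrakk>
      \<Longrightarrow> cmp C w y z (cmp C w x y f g) h = cmp C w x z f (cmp C x y z g h)"

record ('c, 'ca, 'd, 'da) cfunctor =
  fobj :: "'c \<Rightarrow> 'd"
  farr :: "'c \<Rightarrow> 'c \<Rightarrow> 'ca \<Rightarrow> 'da"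

text \<open>
  Both components are extensional (\<open>undefined\<close> outside their domain), so that equality of records
  is equality of functors. The same device is used below for relative monads and for families.
\<close>

definition functors ::
  "('c, 'ca) category \<Rightarrow> ('d, 'da) category \<Rightarrow> ('c, 'ca, 'd, 'da) cfunctor set" where
  "functors C D = {F.
     fobj F \<in> obj C \<rightarrow>\<^sub>E obj D \<and>
     farr F \<in> (\<Pi>\<^sub>E x\<in>obj C. \<Pi>\<^sub>E y\<in>obj C. arr C x y \<rightarrow>\<^sub>E arr D (fobj F x) (fobj F y)) \<and>
     (\<forall>x\<in>obj C. farr F x x (idt C x) = idt D (fobj F x)) \<and>
     (\<forall>x\<in>obj C. \<forall>y\<in>obj C. \<forall>z\<in>obj C. \<forall>f\<in>arr C x y. \<forall>g\<in>arr C y z.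
        farr F x z (cmp C x y z f g)
          = cmp D (fobj F x) (fobj F y) (fobj F z) (farr F x y f) (farr F y z g))}"

text \<open>
  \<open>lact \<O> x' x y f g\<close> is \<open>f;g\<close> for \<open>f : x' \<rightarrow> x\<close> in \<open>C\<close> and \<open>g \<in> \<O>(x,y)\<close>;
  \<open>ract \<O> x y y' g h\<close> is \<open>g;h\<close> for \<open>g \<in> \<O>(x,y)\<close> and \<open>h : y \<rightarrow> y'\<close> in \<open>D\<close>.
\<close>

record ('c, 'ca, 'd, 'da, 'm) bimodule =
  het :: "'c \<Rightarrow> 'd \<Rightarrow> 'm set"
  lact :: "'c \<Rightarrow> 'c \<Rightarrow> 'd \<Rightarrow> 'ca \<Rightarrow> 'm \<Rightarrow> 'm"
  ract :: "'c \<Rightarrow> 'd \<Rightarrow> 'd \<Rightarrow> 'm \<Rightarrow> 'da \<Rightarrow> 'm"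

locale bimodule = C: category C + D: category D
  for C :: "('c, 'ca) category" and D :: "('d, 'da) category" +
  fixes \<O> :: "('c, 'ca, 'd, 'da, 'm) bimodule"
  assumes lact_closed: "\<lbrakk>x' \<in> obj C; x \<in> obj C; y \<in> obj D; f \<in> arr C x' x; g \<in> het \<O> x y\<rbrakk>
      \<Longrightarrow> lact \<O> x' x y f g \<in> het \<O> x' y"
    and ract_closed: "\<lbrakk>x \<in> obj C; y \<in> obj D; y' \<in> obj D; g \<in> het \<O> x y; h \<in> arr D y y'\<rbrakk>
      \<Longrightarrow> ract \<O> x y y' g h \<in> het \<O> x y'"
    and lact_idt: "\<lbrakk>x \<in> obj C; y \<in> obj D; g \<in> het \<O> x y\<rbrakk> \<Longrightarrow> lact \<O> x x y (idt C x) g = g"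
    and ract_idt: "\<lbrakk>x \<in> obj C; y \<in> obj D; g \<in> het \<O> x y\<rbrakk> \<Longrightarrow> ract \<O> x y y g (idt D y) = g"
    and lact_lact: "\<lbrakk>x'' \<in> obj C; x' \<in> obj C; x \<in> obj C; y \<in> obj D;
        f' \<in> arr C x'' x'; f \<in> arr C x' x; g \<in> het \<O> x y\<rbrakk>
      \<Longrightarrow> lact \<O> x'' x y (cmp C x'' x' x f' f) g = lact \<O> x'' x' y f' (lact \<O> x' x y f g)"
    and lact_ract: "\<lbrakk>x' \<in> obj C; x \<in> obj C; y \<in> obj D; y' \<in> obj D;
        f \<in> arr C x' x; g \<in> het \<O> x y; h \<in> arr D y y'\<rbrakk>
      \<Longrightarrow> ract \<O> x' y y' (lact \<O> x' x y f g) h = lact \<O> x' x y' f (ract \<O> x y y' g h)"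
    and ract_ract: "\<lbrakk>x \<in> obj C; y \<in> obj D; y' \<in> obj D; y'' \<in> obj D;
        g \<in> het \<O> x y; h \<in> arr D y y'; h' \<in> arr D y' y''\<rbrakk>
      \<Longrightarrow> ract \<O> x y y'' g (cmp D y y' y'' h h') = ract \<O> x y' y'' (ract \<O> x y y' g h) h'"

locale relative_monad = bimodule C D \<O>
  for C :: "('c, 'ca) category" and D :: "('d, 'da) category"
    and \<O> :: "('c, 'ca, 'd, 'da, 'm) bimodule" +
  fixes T :: "'c \<Rightarrow> 'd" and \<eta> :: "'c \<Rightarrow> 'm" and star :: "'c \<Rightarrow> 'c \<Rightarrow> 'm \<Rightarrow> 'da"
  assumes T_closed: "T \<in> obj C \<rightarrow>\<^sub>E obj D"
    and \<eta>_closed: "\<eta> \<in> (\<Pi>\<^sub>E x\<in>obj C. het \<O> x (T x))"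
    and star_closed: "star \<in> (\<Pi>\<^sub>E x\<in>obj C. \<Pi>\<^sub>E y\<in>obj C. het \<O> x (T y) \<rightarrow>\<^sub>E arr D (T x) (T y))"
    and \<eta>_star: "\<lbrakk>x \<in> obj C; y \<in> obj C; k \<in> het \<O> x (T y)\<rbrakk>
      \<Longrightarrow> ract \<O> x (T x) (T y) (\<eta> x) (star x y k) = k"
    and star_\<eta>: "x \<in> obj C \<Longrightarrow> star x x (\<eta> x) = idt D (T x)"
    and star_star: "\<lbrakk>x \<in> obj C; y \<in> obj C; z \<in> obj C; k \<in> het \<O> x (T y); l \<in> het \<O> y (T z)\<rbrakk>
      \<Longrightarrow> cmp D (T x) (T y) (T z) (star x y k) (star y z l)
        = star x z (ract \<O> x (T y) (T z) k (star y z l))"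

text \<open>
  \<open>tight M as x\<close> is only meaningful for nonempty \<open>as\<close>. The occurrence at which \<open>g \<circ>\<^sub>x f\<close> is taken
  is specified by splitting the domain of \<open>g\<close>:

  \<^item> \<open>compA M as x cs bs y g f\<close>, with \<open>g : as, x, cs \<rightarrow> y\<close> and \<open>f : bs \<rightarrow> x\<close> loose;
  \<^item> \<open>compB M x bs as y g f\<close>, with \<open>g : x, bs \<rightarrow> y\<close> and \<open>f : as \<rightarrow> x\<close> tight;
  \<^item> \<open>compC M as x cs bs y g f\<close>, with \<open>g : as, x, cs \<rightarrow> y\<close> tight, \<open>as\<close> nonempty, \<open>f : bs \<rightarrow> x\<close> loose.
\<close>

record ('o, 'l, 't) skew_multicat =
  mobj :: "'o set"
  loose :: "'o list \<Rightarrow> 'o \<Rightarrow> 'l set"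
  tight :: "'o list \<Rightarrow> 'o \<Rightarrow> 't set"
  loosen :: "'o list \<Rightarrow> 'o \<Rightarrow> 't \<Rightarrow> 'l"
  tid :: "'o \<Rightarrow> 't"
  compA :: "'o list \<Rightarrow> 'o \<Rightarrow> 'o list \<Rightarrow> 'o list \<Rightarrow> 'o \<Rightarrow> 'l \<Rightarrow> 'l \<Rightarrow> 'l"
  compB :: "'o \<Rightarrow> 'o list \<Rightarrow> 'o list \<Rightarrow> 'o \<Rightarrow> 't \<Rightarrow> 't \<Rightarrow> 't"
  compC :: "'o list \<Rightarrow> 'o \<Rightarrow> 'o list \<Rightarrow> 'o list \<Rightarrow> 'o \<Rightarrow> 't \<Rightarrow> 'l \<Rightarrow> 't"

locale left_skew_multicategory =
  fixes M :: "('o, 'l, 't) skew_multicat"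
  assumes loosen_closed:
    "\<And>f.
     \<lbrakk>set as \<subseteq> mobj M; x \<in> mobj M; as \<noteq> []; f \<in> tight M as x\<rbrakk> \<Longrightarrow> loosen M as x f \<in> loose M as x"
  and tid_closed:
    "x \<in> mobj M \<Longrightarrow> tid M x \<in> tight M [x] x"
  and compA_closed:
    "\<And>f g.
     \<lbrakk>set as \<subseteq> mobj M; set bs \<subseteq> mobj M; set cs \<subseteq> mobj M; x \<in> mobj M; y \<in> mobj M;
      g \<in> loose M (as @ x # cs) y; f \<in> loose M bs x\<rbrakk>
     \<Longrightarrow> compA M as x cs bs y g f \<in> loose M (as @ bs @ cs) y"
  and compB_closed:
    "\<And>f g.
     \<lbrakk>set as \<subseteq> mobj M; set bs \<subseteq> mobj M; x \<in> mobj M; y \<in> mobj M; as \<noteq> [];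
      g \<in> tight M (x # bs) y; f \<in> tight M as x\<rbrakk>
     \<Longrightarrow> compB M x bs as y g f \<in> tight M (as @ bs) y"
  and compC_closed:
    "\<And>f g.
     \<lbrakk>set as \<subseteq> mobj M; set bs \<subseteq> mobj M; set cs \<subseteq> mobj M; x \<in> mobj M; y \<in> mobj M; as \<noteq> [];
      g \<in> tight M (as @ x # cs) y; f \<in> loose M bs x\<rbrakk>
     \<Longrightarrow> compC M as x cs bs y g f \<in> tight M (as @ bs @ cs) y"
  and loosen_compB:
    "\<And>f g.
     \<lbrakk>set as \<subseteq> mobj M; set bs \<subseteq> mobj M; x \<in> mobj M; y \<in> mobj M; as \<noteq> [];
      g \<in> tight M (x # bs) y; f \<in> tight M as x\<rbrakk>
     \<Longrightarrow> loosen M (as @ bs) y (compB M x bs as y g f)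
        = compA M [] x bs as y (loosen M (x # bs) y g) (loosen M as x f)"
  and loosen_compC:
    "\<And>f g.
     \<lbrakk>set as \<subseteq> mobj M; set bs \<subseteq> mobj M; set cs \<subseteq> mobj M; x \<in> mobj M; y \<in> mobj M; as \<noteq> [];
      g \<in> tight M (as @ x # cs) y; f \<in> loose M bs x\<rbrakk>
     \<Longrightarrow> loosen M (as @ bs @ cs) y (compC M as x cs bs y g f)
        = compA M as x cs bs y (loosen M (as @ x # cs) y g) f"
  and compA_tid_right:
    "\<And>g.
     \<lbrakk>set as \<subseteq> mobj M; set cs \<subseteq> mobj M; x \<in> mobj M; y \<in> mobj M; g \<in> loose M (as @ x # cs) y\<rbrakk>
     \<Longrightarrow> compA M as x cs [x] y g (loosen M [x] x (tid M x)) = g"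
  and compB_tid_right:
    "\<And>g.
     \<lbrakk>set bs \<subseteq> mobj M; x \<in> mobj M; y \<in> mobj M; g \<in> tight M (x # bs) y\<rbrakk>
     \<Longrightarrow> compB M x bs [x] y g (tid M x) = g"
  and compC_tid_right:
    "\<And>g.
     \<lbrakk>set as \<subseteq> mobj M; set cs \<subseteq> mobj M; x \<in> mobj M; y \<in> mobj M; as \<noteq> [];
      g \<in> tight M (as @ x # cs) y\<rbrakk>
     \<Longrightarrow> compC M as x cs [x] y g (loosen M [x] x (tid M x)) = g"
  and compA_tid_left:
    "\<And>f.
     \<lbrakk>set as \<subseteq> mobj M; x \<in> mobj M; f \<in> loose M as x\<rbrakk>
     \<Longrightarrow> compA M [] x [] as x (loosen M [x] x (tid M x)) f = f"
  and compB_tid_left: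
    "\<And>f.
     \<lbrakk>set as \<subseteq> mobj M; x \<in> mobj M; as \<noteq> []; f \<in> tight M as x\<rbrakk>
     \<Longrightarrow> compB M x [] as x (tid M x) f = f"
  \<comment> \<open>associativity; the types of \<open>h\<close> and of the occurrence of \<open>y\<close> leave just these cases\<close>
  and assoc_AA:
    "\<And>f g h.
     \<lbrakk>set as \<subseteq> mobj M; set bs \<subseteq> mobj M; set cs \<subseteq> mobj M; set ds \<subseteq> mobj M; set es \<subseteq> mobj M;
      x \<in> mobj M; y \<in> mobj M; z \<in> mobj M;
      f \<in> loose M as x; g \<in> loose M (bs @ x # cs) y; h \<in> loose M (ds @ y # es) z\<rbrakk>
     \<Longrightarrow> compA M ds y es (bs @ as @ cs) z h (compA M bs x cs as y g f)
        = compA M (ds @ bs) x (cs @ es) as z (compA M ds y es (bs @ x # cs) z h g) f"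
  and assoc_CA:
    "\<And>f g h.
     \<lbrakk>set as \<subseteq> mobj M; set bs \<subseteq> mobj M; set cs \<subseteq> mobj M; set ds \<subseteq> mobj M; set es \<subseteq> mobj M;
      x \<in> mobj M; y \<in> mobj M; z \<in> mobj M; ds \<noteq> [];
      f \<in> loose M as x; g \<in> loose M (bs @ x # cs) y; h \<in> tight M (ds @ y # es) z\<rbrakk>
     \<Longrightarrow> compC M ds y es (bs @ as @ cs) z h (compA M bs x cs as y g f)
        = compC M (ds @ bs) x (cs @ es) as z (compC M ds y es (bs @ x # cs) z h g) f"
  and assoc_BB:
    "\<And>f g h.
     \<lbrakk>set as \<subseteq> mobj M; set cs \<subseteq> mobj M; set es \<subseteq> mobj M;
      x \<in> mobj M; y \<in> mobj M; z \<in> mobj M; as \<noteq> [];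
      f \<in> tight M as x; g \<in> tight M (x # cs) y; h \<in> tight M (y # es) z\<rbrakk>
     \<Longrightarrow> compB M y es (as @ cs) z h (compB M x cs as y g f)
        = compB M x (cs @ es) as z (compB M y es (x # cs) z h g) f"
  and assoc_BC:
    "\<And>f g h.
     \<lbrakk>set as \<subseteq> mobj M; set bs \<subseteq> mobj M; set cs \<subseteq> mobj M; set es \<subseteq> mobj M;
      x \<in> mobj M; y \<in> mobj M; z \<in> mobj M; bs \<noteq> [];
      f \<in> loose M as x; g \<in> tight M (bs @ x # cs) y; h \<in> tight M (y # es) z\<rbrakk>
     \<Longrightarrow> compB M y es (bs @ as @ cs) z h (compC M bs x cs as y g f)
        = compC M bs x (cs @ es) as z (compB M y es (bs @ x # cs) z h g) f"
  and interchange_AA: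
    "\<And>f g h.
     \<lbrakk>set as \<subseteq> mobj M; set bs \<subseteq> mobj M; set cs \<subseteq> mobj M; set ds \<subseteq> mobj M; set es \<subseteq> mobj M;
      x \<in> mobj M; y \<in> mobj M; z \<in> mobj M;
      f \<in> loose M ds x; g \<in> loose M es y; h \<in> loose M (as @ x # bs @ y # cs) z\<rbrakk>
     \<Longrightarrow> compA M (as @ ds @ bs) y cs es z (compA M as x (bs @ y # cs) ds z h f) g
        = compA M as x (bs @ es @ cs) ds z (compA M (as @ x # bs) y cs es z h g) f"
  and interchange_CC:
    "\<And>f g h.
     \<lbrakk>set as \<subseteq> mobj M; set bs \<subseteq> mobj M; set cs \<subseteq> mobj M; set ds \<subseteq> mobj M; set es \<subseteq> mobj M;
      x \<in> mobj M; y \<in> mobj M; z \<in> mobj M; as \<noteq> [];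
      f \<in> loose M ds x; g \<in> loose M es y; h \<in> tight M (as @ x # bs @ y # cs) z\<rbrakk>
     \<Longrightarrow> compC M (as @ ds @ bs) y cs es z (compC M as x (bs @ y # cs) ds z h f) g
        = compC M as x (bs @ es @ cs) ds z (compC M (as @ x # bs) y cs es z h g) f"
  and interchange_BC:
    "\<And>f g h.
     \<lbrakk>set bs \<subseteq> mobj M; set cs \<subseteq> mobj M; set ds \<subseteq> mobj M; set es \<subseteq> mobj M;
      x \<in> mobj M; y \<in> mobj M; z \<in> mobj M; ds \<noteq> [];
      f \<in> tight M ds x; g \<in> loose M es y; h \<in> tight M (x # bs @ y # cs) z\<rbrakk>
     \<Longrightarrow> compC M (ds @ bs) y cs es z (compB M x (bs @ y # cs) ds z h f) g
        = compB M x (bs @ es @ cs) ds z (compC M (x # bs) y cs es z h g) f"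

definition skew_monoids :: "('o, 'l, 't) skew_multicat \<Rightarrow> ('o \<times> 't \<times> 'l) set" where
  "skew_monoids M = {(x, m, e).
     x \<in> mobj M \<and> m \<in> tight M [x, x] x \<and> e \<in> loose M [] x \<and>
     compA M [] x [x] [] x (loosen M [x, x] x m) e = loosen M [x] x (tid M x) \<and>
     compC M [x] x [] [] x m e = tid M x \<and>
     compB M x [x] [x, x] x m m = compC M [x] x [] [x, x] x m (loosen M [x, x] x m)}"

text \<open>
  A family \<open>f\<close> is applied to the list \<open>[x\<^sub>0, \<dots>, x\<^sub>n]\<close> of objects and to a list
  \<open>[k\<^sub>0, \<dots>, k\<^sub>n\<^sub>-\<^sub>1]\<close> with \<open>k\<^sub>i \<in> \<O>(x\<^sub>i, T\<^sub>i x\<^sub>i\<^sub>+\<^sub>1)\<close>.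
\<close>

definition objs :: "('c, 'ca) category \<Rightarrow> nat \<Rightarrow> 'c list set" where
  "objs C n = {xs. length xs = n \<and> set xs \<subseteq> obj C}"

definition args :: "('c, 'ca, 'd, 'da, 'm) bimodule \<Rightarrow> ('c, 'ca, 'd, 'da) cfunctor list \<Rightarrow> 'c list
    \<Rightarrow> 'm list set" where
  "args \<O> Ts xs = {ks. length ks = length Ts \<and>
     (\<forall>i<length Ts. ks ! i \<in> het \<O> (xs ! i) (fobj (Ts ! i) (xs ! Suc i)))}"

text \<open>
  Families take values in a bimodule \<open>P\<close>: loose ones in \<open>\<O>\<close>, tight ones with first functor \<open>S\<close> in
  \<open>companion D S\<close>, that is \<open>(x, y) \<mapsto> D(S x, y)\<close>, on which \<open>u\<close> in \<open>C\<close> acts on the left as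
  composition with \<open>S u\<close>.
\<close>

definition companion :: "('d, 'da) category \<Rightarrow> ('c, 'ca, 'd, 'da) cfunctor
    \<Rightarrow> ('c, 'ca, 'd, 'da, 'da) bimodule" where
  "companion D S = \<lparr>
     het = (\<lambda>x y. arr D (fobj S x) y),
     lact = (\<lambda>x' x y u g. cmp D (fobj S x') (fobj S x) y (farr S x' x u) g),
     ract = (\<lambda>x y y' g h. cmp D (fobj S x) y y' g h)\<rparr>"

text \<open>
  In the first clause (an intermediate \<open>x\<^sub>i\<close>), \<open>ks ! i\<close> is typed over the codomain \<open>x'\<close> of
  \<open>u : x\<^sub>i \<rightarrow> x'\<close>, all other entries over \<open>xs\<close>. The others concern \<open>x\<^sub>n\<close> and \<open>x\<^sub>0\<close>
  for \<open>n > 0\<close>, and \<open>n = 0\<close>.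
\<close>

definition extranatural :: "('c, 'ca) category \<Rightarrow> ('c, 'ca, 'd, 'da, 'm) bimodule
    \<Rightarrow> ('c, 'ca, 'd, 'da, 'p) bimodule
    \<Rightarrow> ('c, 'ca, 'd, 'da) cfunctor list \<Rightarrow> ('c, 'ca, 'd, 'da) cfunctor
    \<Rightarrow> ('c list \<Rightarrow> 'm list \<Rightarrow> 'p) \<Rightarrow> bool" where
  "extranatural C \<O> P Ts H f \<longleftrightarrow> (let n = length Ts in
     (\<forall>i xs x' u ks.
        0 < i \<and> i < n \<and> xs \<in> objs C (Suc n) \<and> x' \<in> obj C \<and> u \<in> arr C (xs ! i) x' \<and>
        length ks = n \<and>
        (\<forall>j<n. ks ! j \<in> het \<O> (if j = i then x' else xs ! j) (fobj (Ts ! j) (xs ! Suc j))) \<longrightarrow>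
        f (xs[i := x'])
          (ks[i - 1 := ract \<O> (xs ! (i - 1)) (fobj (Ts ! (i - 1)) (xs ! i)) (fobj (Ts ! (i - 1)) x')
                         (ks ! (i - 1)) (farr (Ts ! (i - 1)) (xs ! i) x' u)])
        = f xs (ks[i := lact \<O> (xs ! i) x' (fobj (Ts ! i) (xs ! Suc i)) u (ks ! i)])) \<and>
     (\<forall>xs x' u ks.
        0 < n \<and> xs \<in> objs C (Suc n) \<and> x' \<in> obj C \<and> u \<in> arr C (xs ! n) x' \<and> ks \<in> args \<O> Ts xs \<longrightarrow>
        f (xs[n := x'])
          (ks[n - 1 := ract \<O> (xs ! (n - 1)) (fobj (Ts ! (n - 1)) (xs ! n)) (fobj (Ts ! (n - 1)) x')
                         (ks ! (n - 1)) (farr (Ts ! (n - 1)) (xs ! n) x' u)])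
        = ract P (xs ! 0) (fobj H (xs ! n)) (fobj H x') (f xs ks) (farr H (xs ! n) x' u)) \<and>
     (\<forall>xs x u ks.
        0 < n \<and> xs \<in> objs C (Suc n) \<and> x \<in> obj C \<and> u \<in> arr C x (xs ! 0) \<and> ks \<in> args \<O> Ts xs \<longrightarrow>
        f (xs[0 := x]) (ks[0 := lact \<O> x (xs ! 0) (fobj (Ts ! 0) (xs ! 1)) u (ks ! 0)])
        = lact P x (xs ! 0) (fobj H (xs ! n)) u (f xs ks)) \<and>
     (n = 0 \<longrightarrow> (\<forall>x\<in>obj C. \<forall>x'\<in>obj C. \<forall>u\<in>arr C x x'.
        lact P x x' (fobj H x') u (f [x'] [])
        = ract P x (fobj H x) (fobj H x') (f [x] []) (farr H x x' u))))"

definition families :: "('c, 'ca) category \<Rightarrow> ('c, 'ca, 'd, 'da, 'm) bimodule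
    \<Rightarrow> ('c, 'ca, 'd, 'da, 'p) bimodule
    \<Rightarrow> ('c, 'ca, 'd, 'da) cfunctor list \<Rightarrow> ('c, 'ca, 'd, 'da) cfunctor
    \<Rightarrow> ('c list \<Rightarrow> 'm list \<Rightarrow> 'p) set" where
  "families C \<O> P Ts H = {f.
     f \<in> (\<Pi>\<^sub>E xs\<in>objs C (Suc (length Ts)). args \<O> Ts xs \<rightarrow>\<^sub>E het P (xs ! 0) (fobj H (xs ! length Ts))) \<and>
     extranatural C \<O> P Ts H f}"

text \<open>
  Substitution of \<open>f\<close>, which has \<open>q\<close> arguments, for argument number \<open>p\<close> of \<open>g\<close>: \<open>f\<close> is applied to
  \<open>[x\<^sub>p, \<dots>, x\<^sub>p\<^sub>+\<^sub>q]\<close>, and \<open>g\<close> to \<open>[x\<^sub>0, \<dots>, x\<^sub>p, x\<^sub>p\<^sub>+\<^sub>q, \<dots>, x\<^sub>n]\<close> (with \<open>x\<^sub>p\<close> repeated if \<open>q = 0\<close>).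
\<close>

definition subst_at :: "nat \<Rightarrow> nat \<Rightarrow> ('c list \<Rightarrow> 'm list \<Rightarrow> 'p) \<Rightarrow> ('c list \<Rightarrow> 'm list \<Rightarrow> 'm)
    \<Rightarrow> 'c list \<Rightarrow> 'm list \<Rightarrow> 'p" where
  "subst_at p q g f xs ks =
     g (take (Suc p) xs @ drop (p + q) xs)
       (take p ks @ [f (take (Suc q) (drop p xs)) (take q (drop p ks))] @ drop (p + q) ks)"

text \<open>
  A tight \<open>f : S, T\<^sub>0, \<dots>, T\<^sub>n\<^sub>-\<^sub>1 \<rightarrow> H\<close> takes arguments for \<open>T\<^sub>0, \<dots>, T\<^sub>n\<^sub>-\<^sub>1\<close> only, so position
  \<open>length as\<close> in its domain is argument number \<open>length (tl as)\<close> (case \<open>compC\<close>).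
\<close>

definition bimodule_multicat :: "('c, 'ca) category \<Rightarrow> ('d, 'da) category
    \<Rightarrow> ('c, 'ca, 'd, 'da, 'm) bimodule
    \<Rightarrow> (('c, 'ca, 'd, 'da) cfunctor, 'c list \<Rightarrow> 'm list \<Rightarrow> 'm, 'c list \<Rightarrow> 'm list \<Rightarrow> 'da) skew_multicat"
where
  "bimodule_multicat C D \<O> = \<lparr>
     mobj = functors C D,
     loose = (\<lambda>Ts H. families C \<O> \<O> Ts H),
     tight = (\<lambda>Ts H. families C \<O> (companion D (hd Ts)) (tl Ts) H),
     loosen = (\<lambda>Ts H f. \<lambda>xs\<in>objs C (Suc (length Ts)). \<lambda>ks\<in>args \<O> Ts xs.
       ract \<O> (xs ! 0) (fobj (hd Ts) (xs ! 1)) (fobj H (xs ! length Ts)) (hd ks) (f (tl xs) (tl ks))),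
     tid = (\<lambda>S. \<lambda>xs\<in>objs C 1. \<lambda>ks\<in>args \<O> [] xs. idt D (fobj S (xs ! 0))),
     compA = (\<lambda>as x cs bs y g f.
       \<lambda>xs\<in>objs C (Suc (length (as @ bs @ cs))). \<lambda>ks\<in>args \<O> (as @ bs @ cs) xs.
         subst_at (length as) (length bs) g f xs ks),
     compB = (\<lambda>x bs as y g f.
       \<lambda>xs\<in>objs C (Suc (length (tl as @ bs))). \<lambda>ks\<in>args \<O> (tl as @ bs) xs.
         let p = length (tl as); n = length (tl as @ bs) in
         cmp D (fobj (hd as) (xs ! 0)) (fobj x (xs ! p)) (fobj y (xs ! n))
           (f (take (Suc p) xs) (take p ks)) (g (drop p xs) (drop p ks))),
     compC = (\<lambda>as x cs bs y g f.
       \<lambda>xs\<in>objs C (Suc (length (tl as @ bs @ cs))). \<lambda>ks\<in>args \<O> (tl as @ bs @ cs) xs.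
         subst_at (length (tl as)) (length bs) g f xs ks)\<rparr>"

definition monoid_to_relative_monad :: "('c, 'ca) category \<Rightarrow> ('c, 'ca, 'd, 'da, 'm) bimodule
    \<Rightarrow> ('c, 'ca, 'd, 'da) cfunctor \<times> ('c list \<Rightarrow> 'm list \<Rightarrow> 'da) \<times> ('c list \<Rightarrow> 'm list \<Rightarrow> 'm)
    \<Rightarrow> ('c \<Rightarrow> 'd) \<times> ('c \<Rightarrow> 'm) \<times> ('c \<Rightarrow> 'c \<Rightarrow> 'm \<Rightarrow> 'da)" where
  "monoid_to_relative_monad C \<O> = (\<lambda>(T, m, e).
     (fobj T,
      \<lambda>x\<in>obj C. e [x] [],
      \<lambda>x\<in>obj C. \<lambda>y\<in>obj C. \<lambda>k\<in>het \<O> x (fobj T y). m [x, y] [k]))"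

end

theory Submission
  imports Defs
begin

text \<open>
  Extranaturality amounts to one equation for each splitting of the domain of a family, uniform in
  whether the splitting is at an end. All operations come from two: substituting a loose family
  for an argument of a family valued in any bimodule, and composing a family valued in any bimodule
  with a tight family. Loosening is composition after the identity loose family, so the axioms on
  loosening are instances of the laws relating these two operations.

  For a monoid \<open>(T, m, e)\<close>, naturality of \<open>m\<close> in \<open>x\<^sub>0\<close> and the unit law \<open>m(e) = id\<close> give
  \<open>m(u;e) = T u; m(e) = T u\<close>, so the action of \<open>T\<close> on morphisms is redundant. Conversely a relative monad
  becomes a functor by \<open>T u = (u;\<eta>)\<^sup>*\<close>, for which \<open>\<eta>\<close> and \<open>k \<mapsto> k\<^sup>*\<close> are extranatural, and the monoid laws
  are the relative monad laws.
\<close>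

text \<open>The delicate places are the joints between blocks of arguments. If the substituted
  family is nullary, both its ends sit at the same object, which then occurs twice among the objects
  of the outer family. Moving an arrow past this object takes three equations: the outer family
  turns it into an action on the value of the inner one, the inner family exchanges left action for
  right action, and the outer family releases it on the other side. This is why an action on a
  missing argument is read as an action on the value: it makes the end equations of the inner family
  fit into the outer one. Equalities between composites are of another kind. All families are
  \<open>undefined\<close> off well-typed inputs, so it is enough to cut a typed path of objects and
  arguments into blocks and evaluate both sides. In the laws about substitution alone, the outermost
  family is merely applied, never acted on, so one law serves loose and tight outer families alike.
  Algebra in the value bimodule enters only through composition with a tight family.\<close>

lemma functorsD:
  assumes "F \<in> functors C D"
  shows "x \<in> obj C \<Longrightarrow> fobj F x \<in> obj D"
    and "\<lbrakk>x \<in> obj C; y \<in> obj C; u \<in> arr C x y\<rbrakk> \<Longrightarrow> farr F x y u \<in> arr D (fobj F x) (fobj F y)"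
    and "x \<in> obj C \<Longrightarrow> farr F x x (idt C x) = idt D (fobj F x)"
    and "\<lbrakk>x \<in> obj C; y \<in> obj C; z \<in> obj C; u \<in> arr C x y; v \<in> arr C y z\<rbrakk> \<Longrightarrow>
      farr F x z (cmp C x y z u v)
        = cmp D (fobj F x) (fobj F y) (fobj F z) (farr F x y u) (farr F y z v)"
  using assms unfolding functors_def by (auto simp: PiE_iff)

text \<open>Off the hom-sets both arrow parts are \<open>undefined\<close>, so agreement on actual
  arrows is enough.\<close>

lemma functor_eqI:
  assumes "F \<in> functors C D" "G \<in> functors C D" "fobj F = fobj G"
    and "\<And>x y u. \<lbrakk>x \<in> obj C; y \<in> obj C; u \<in> arr C x y\<rbrakk> \<Longrightarrow> farr F x y u = farr G x y u"
  shows "F = G"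
proof -
  have 1: "farr H \<in> (\<Pi>\<^sub>E x\<in>obj C. \<Pi>\<^sub>E y\<in>obj C. arr C x y \<rightarrow>\<^sub>E arr D (fobj H x) (fobj H y))"
    if "H \<in> functors C D" for H using that by (simp add: functors_def)
  have "farr F x y u = farr G x y u" for x y u
    using assms(4)[of x y u] 1[OF assms(1)] 1[OF assms(2)]
    by (cases "x \<in> obj C"; cases "y \<in> obj C"; cases "u \<in> arr C x y")
      (auto simp: PiE_iff extensional_def)
  then have "farr F = farr G" by blast
  with assms(3) show ?thesis by simp
qed

context bimodule
begin

text \<open>Functoriality of \<open>S\<close> gives the unit and composition laws of the left
  action; the remaining laws are those of \<open>D\<close>. It lets tight families be handled as
  families valued in a bimodule.\<close>

lemma companion_bimodule:
  assumes "S \<in> functors C D"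
  shows "bimodule C D (companion D S)"
proof unfold_locales
qed (use functorsD[OF assms] in
    \<open>auto simp: companion_def D.idt_cmp D.cmp_idt D.cmp_assoc intro!: D.cmp_closed\<close>)

subsection \<open>Objects and arguments of a family\<close>

text \<open>Typing by indices into two lists is awkward to cut. Joining both memberships in one
  predicate gives a path that can be split and glued like a list.\<close>

definition chain :: "('c, 'ca, 'd, 'da) cfunctor list \<Rightarrow> 'c list \<Rightarrow> 'm list \<Rightarrow> bool" where
  "chain Ts xs ks \<longleftrightarrow> xs \<in> objs C (Suc (length Ts)) \<and> ks \<in> args \<O> Ts xs"

lemma chain_length:
  assumes "chain Ts xs ks"
  shows "length xs = Suc (length Ts)" "length ks = length Ts"
  using assms by (auto simp: chain_def objs_def args_def)

lemma chain_objs: "chain Ts xs ks \<Longrightarrow> set xs \<subseteq> obj C"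
  by (auto simp: chain_def objs_def)

lemma chain_hd_last:
  assumes "chain Ts xs ks"
  shows "xs \<noteq> []" "hd xs \<in> obj C" "last xs \<in> obj C"
  using chain_length[OF assms] chain_objs[OF assms] by (cases xs; auto)+

lemma chain_Nil [simp]: "chain [] xs ks \<longleftrightarrow> (\<exists>x\<in>obj C. xs = [x]) \<and> ks = []"
  by (auto simp: chain_def objs_def args_def length_Suc_conv)

lemma chain_Cons:
  "chain (T # Ts) (x # xs) (k # ks)
    \<longleftrightarrow> x \<in> obj C \<and> k \<in> het \<O> x (fobj T (hd xs)) \<and> chain Ts xs ks"
proof (cases xs)
  case (Cons y ys)
  have "(\<forall>i<Suc (length Ts). P i) \<longleftrightarrow> P 0 \<and> (\<forall>i<length Ts. P (Suc i))" for P
    by (auto simp: less_Suc_eq_0_disj)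
  with Cons show ?thesis by (auto simp: chain_def objs_def args_def)
qed (simp add: chain_def objs_def)

lemma chain_ConsE:
  assumes "chain (T # Ts) xs ks"
  obtains x y ys k ls where "xs = x # y # ys" "ks = k # ls" "x \<in> obj C" "y \<in> obj C"
    "k \<in> het \<O> x (fobj T y)" "chain Ts (y # ys) ls"
proof -
  from chain_length[OF assms] obtain x y ys k ls where "xs = x # y # ys" "ks = k # ls"
    by (auto simp: length_Suc_conv)
  with assms that show ?thesis by (auto simp: chain_Cons dest: chain_objs)
qed

text \<open>There is one more object than there are arguments, so the object \<open>x\<close> at the
  cut belongs to both halves. The length hypotheses fix where the cut lies.\<close>

lemma chain_append:
  "\<lbrakk>length ys = length As; length ks = length As\<rbrakk> \<Longrightarrow>
    chain (As @ Bs) (ys @ x # zs) (ks @ ls) \<longleftrightarrow> chain As (ys @ [x]) ks \<and> chain Bs (x # zs) ls"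
proof (induction As arbitrary: ys ks)
  case Nil
  then show ?case by (auto dest: chain_objs)
next
  case (Cons A As)
  then obtain y ys' k ks' where *: "ys = y # ys'" "ks = k # ks'" 
    by (metis length_Suc_conv list.size(4) add.commute plus_1_eq_Suc)
  with Cons have "chain (As @ Bs) (ys' @ x # zs) (ks' @ ls)
      \<longleftrightarrow> chain As (ys' @ [x]) ks' \<and> chain Bs (x # zs) ls" by simp
  then show ?case by (cases ys') (auto simp: * chain_Cons)
qed

lemma chain_splitE:
  assumes "chain (As @ Bs) xs ks"
  obtains ys x zs ks1 ks2 where "xs = ys @ x # zs" "ks = ks1 @ ks2" "length ys = length As"
    "chain As (ys @ [x]) ks1" "chain Bs (x # zs) ks2"
proof -
  let ?n = "length As"
  have len: "length xs = Suc (?n + length Bs)" "length ks = ?n + length Bs"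
    using chain_length[OF assms] by auto
  have "xs = take ?n xs @ xs ! ?n # drop (Suc ?n) xs" using len by (simp add: id_take_nth_drop)
  moreover have "ks = take ?n ks @ drop ?n ks" by simp
  ultimately obtain ys x zs ks1 ks2 where *: "xs = ys @ x # zs" "ks = ks1 @ ks2"
    "length ys = ?n" "length ks1 = ?n" using len
    by (metis (no_types, lifting) le_add1 le_SucI length_take min.absorb2)
  with assms that show ?thesis by (auto simp: chain_append)
qed

lemma chain_rev:
  "chain (As @ [A]) (ys @ [y, x]) (ks @ [k])
    \<longleftrightarrow> length ys = length As \<and> chain As (ys @ [y]) ks \<and> x \<in> obj C \<and> k \<in> het \<O> y (fobj A x)"
proof -
  have "chain (As @ [A]) (ys @ [y, x]) (ks @ [k]) \<Longrightarrow> length ys = length As \<and> length ks = length As"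
    using chain_length[of "As @ [A]" "ys @ [y, x]" "ks @ [k]"] by simp
  moreover have "chain As (ys @ [y]) ks \<Longrightarrow> length ys = length As \<and> length ks = length As \<and> y \<in> obj C"
    using chain_length[of As "ys @ [y]" ks] chain_objs[of As "ys @ [y]" ks] by simp
  ultimately show ?thesis using chain_append[of ys As ks "[A]" y "[x]" "[k]"]
    by (auto simp: chain_Cons)
qed

lemma chain_revE:
  assumes "chain (As @ [A]) (ys @ [x]) ks"
  obtains ys' y ks' k where "ys = ys' @ [y]" "ks = ks' @ [k]" "length ys' = length As"
    "chain As (ys' @ [y]) ks'" "x \<in> obj C" "y \<in> obj C" "k \<in> het \<O> y (fobj A x)"
proof -
  from chain_length[OF assms] obtain ys' y ks' k where "ys = ys' @ [y]" "ks = ks' @ [k]"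
    by (cases ys rule: rev_cases; cases ks rule: rev_cases) auto
  with assms that[of ys' y ks' k] chain_objs[of As "ys' @ [y]" ks'] show ?thesis
    by (simp add: chain_rev)
qed

lemma chain_append3:
  assumes "length ys = length As" "chain As (ys @ [hd ws]) ks" "chain Bs ws ls"
    "chain Cs (last ws # zs) ms"
  shows "chain (As @ Bs @ Cs) (ys @ ws @ zs) (ks @ ls @ ms)"
proof -
  obtain ws' w where ws: "ws = ws' @ [w]" using chain_hd_last[OF assms(3)] by (metis rev_exhaust)
  have 1: "chain (Bs @ Cs) (ws @ zs) (ls @ ms)"
    using assms(3,4) chain_length[OF assms(3)] chain_append[of ws' Bs ls Cs w zs ms] by (simp add: ws)
  obtain v vs where v: "ws = v # vs" using ws by (metis list.exhaust snoc_eq_iff_butlast)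
  show ?thesis
    using assms(1,2) 1 chain_length[OF assms(2)] chain_append[of ys As ks "Bs @ Cs" v "vs @ zs"]
    by (simp add: v)
qed

lemma chain_split3E:
  assumes "chain (As @ Bs @ Cs) xs ks"
  obtains ys ws zs ks1 ks2 ks3 where "xs = ys @ ws @ zs" "ks = ks1 @ ks2 @ ks3"
    "length ys = length As" "length ks1 = length As" "length ws = Suc (length Bs)"
    "length ks2 = length Bs" "length zs = length Cs" "length ks3 = length Cs"
    "chain As (ys @ [hd ws]) ks1" "chain Bs ws ks2" "chain Cs (last ws # zs) ks3"
proof -
  from assms obtain ys x zs ks1 ks2 where 1: "xs = ys @ x # zs" "ks = ks1 @ ks2"
    "length ys = length As" "chain As (ys @ [x]) ks1" "chain (Bs @ Cs) (x # zs) ks2"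
    by (rule chain_splitE)
  from 1(5) obtain vs v zs' ks3 ks4 where 2: "x # zs = vs @ v # zs'" "ks2 = ks3 @ ks4"
    "chain Bs (vs @ [v]) ks3" "chain Cs (v # zs') ks4"
    by (rule chain_splitE)
  have "hd (vs @ [v]) = x" using 2(1) by (cases vs) auto
  then show ?thesis using that[of ys "vs @ [v]" zs' ks1 ks3 ks4] 1 2
      chain_length[OF 1(4)] chain_length[OF 2(3)] chain_length[OF 2(4)] by simp
qed

text \<open>This is the restriction built into every operation of \<open>bimodule_multicat\<close>.
  Two families restricted this way are equal as soon as they agree on chains.\<close>

definition fam :: "('c, 'ca, 'd, 'da) cfunctor list \<Rightarrow> ('c list \<Rightarrow> 'm list \<Rightarrow> 'p)
    \<Rightarrow> 'c list \<Rightarrow> 'm list \<Rightarrow> 'p" where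
  "fam Ts h = (\<lambda>xs\<in>objs C (Suc (length Ts)). \<lambda>ks\<in>args \<O> Ts xs. h xs ks)"

lemma fam_apply: "chain Ts xs ks \<Longrightarrow> fam Ts h xs ks = h xs ks"
  by (simp add: fam_def chain_def)

lemma fam_cong: "(\<And>xs ks. chain Ts xs ks \<Longrightarrow> h xs ks = h' xs ks) \<Longrightarrow> fam Ts h = fam Ts h'"
  unfolding fam_def chain_def by (intro restrict_ext) blast

subsection \<open>Extranaturality at a splitting of the domain\<close>

text \<open>
  The four clauses of \<open>extranatural\<close> are one equation \<open>slide_left = slide_right\<close> per splitting
  \<open>As @ Bs\<close> of the domain: \<open>u : x \<rightarrow> x'\<close> acts on the last argument for \<open>As\<close> or on the first
  argument for \<open>Bs\<close>, and where that part is empty it acts on the value of the family instead.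
  The arguments \<open>ks\<close> end over \<open>x\<close>, whereas \<open>ls\<close> start over \<open>x'\<close>.
\<close>

definition act_last :: "('c, 'ca, 'd, 'da) cfunctor list \<Rightarrow> 'c list \<Rightarrow> 'c \<Rightarrow> 'c \<Rightarrow> 'ca
    \<Rightarrow> 'm list \<Rightarrow> 'm list" where
  "act_last As ys x x' u ks = (if As = [] then []
     else butlast ks @ [ract \<O> (last ys) (fobj (last As) x) (fobj (last As) x')
                          (last ks) (farr (last As) x x' u)])"

definition act_first :: "('c, 'ca, 'd, 'da) cfunctor list \<Rightarrow> 'c \<Rightarrow> 'c \<Rightarrow> 'c list \<Rightarrow> 'ca
    \<Rightarrow> 'm list \<Rightarrow> 'm list" where
  "act_first Bs x x' zs u ks = (if Bs = [] then []
     else lact \<O> x x' (fobj (hd Bs) (hd zs)) u (hd ks) # tl ks)"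

definition slide_left :: "('c, 'ca, 'd, 'da, 'p) bimodule
    \<Rightarrow> ('c, 'ca, 'd, 'da) cfunctor \<Rightarrow> ('c list \<Rightarrow> 'm list \<Rightarrow> 'p)
    \<Rightarrow> ('c, 'ca, 'd, 'da) cfunctor list \<Rightarrow> 'c list \<Rightarrow> 'c \<Rightarrow> 'c \<Rightarrow> 'c list \<Rightarrow> 'ca
    \<Rightarrow> 'm list \<Rightarrow> 'm list \<Rightarrow> 'p" where
  "slide_left P H f As ys x x' zs u ks ls =
     (if As = [] then lact P x x' (fobj H (last (x' # zs))) u (f (x' # zs) ls)
      else f (ys @ x' # zs) (act_last As ys x x' u ks @ ls))"

definition slide_right :: "('c, 'ca, 'd, 'da, 'p) bimodule
    \<Rightarrow> ('c, 'ca, 'd, 'da) cfunctor \<Rightarrow> ('c list \<Rightarrow> 'm list \<Rightarrow> 'p)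
    \<Rightarrow> ('c, 'ca, 'd, 'da) cfunctor list \<Rightarrow> 'c list \<Rightarrow> 'c \<Rightarrow> 'c \<Rightarrow> 'c list \<Rightarrow> 'ca
    \<Rightarrow> 'm list \<Rightarrow> 'm list \<Rightarrow> 'p" where
  "slide_right P H f Bs ys x x' zs u ks ls =
     (if Bs = [] then ract P (hd (ys @ [x])) (fobj H x) (fobj H x') (f (ys @ [x]) ks) (farr H x x' u)
      else f (ys @ x # zs) (ks @ act_first Bs x x' zs u ls))"

definition natural :: "('c, 'ca, 'd, 'da, 'p) bimodule \<Rightarrow> ('c, 'ca, 'd, 'da) cfunctor list \<Rightarrow> ('c, 'ca, 'd, 'da) cfunctor
    \<Rightarrow> ('c list \<Rightarrow> 'm list \<Rightarrow> 'p) \<Rightarrow> bool" where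
  "natural P Ts H f \<longleftrightarrow> (\<forall>As Bs ys x x' zs u ks ls.
     Ts = As @ Bs \<and> u \<in> arr C x x' \<and> chain As (ys @ [x]) ks \<and> chain Bs (x' # zs) ls \<longrightarrow>
     slide_left P H f As ys x x' zs u ks ls = slide_right P H f Bs ys x x' zs u ks ls)"

text \<open>Argument \<open>j\<close> is typed by objects \<open>j\<close> and \<open>j + 1\<close>.
  Replacing the source of argument \<open>length As\<close> alone leaves the arguments before it
  ending over \<open>x\<close>, and makes the remaining ones start over \<open>x'\<close>.\<close>

lemma intermediate_args_iff:
  assumes "length ys = length As" "length zs = length Bs" "length ks = length As"
    "length ls = length Bs" "set (ys @ x # zs) \<subseteq> obj C" "x' \<in> obj C"
  shows "(\<forall>j<length (As @ Bs). (ks @ ls) ! j \<in> het \<O> (if j = length As then x' else (ys @ x # zs) ! j)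
            (fobj ((As @ Bs) ! j) ((ys @ x # zs) ! Suc j)))
    \<longleftrightarrow> chain As (ys @ [x]) ks \<and> chain Bs (x' # zs) ls" (is "(\<forall>j<_. ?Q j) \<longleftrightarrow> _")
proof -
  let ?n = "length As"
  have split: "(\<forall>j<length (As @ Bs). ?Q j) \<longleftrightarrow> (\<forall>j<?n. ?Q j) \<and> (\<forall>j<length Bs. ?Q (?n + j))"
    (is "?l \<longleftrightarrow> ?r")
  proof
    assume ?r
    have "?Q j" if "j < length (As @ Bs)" for j
    proof (cases "j < ?n")
      case False
      then obtain i where "j = ?n + i" using le_Suc_ex not_less by blast
      with that \<open>?r\<close>[THEN conjunct2, THEN spec, of i] show ?thesis by (auto split: if_splits)
    qed (use \<open>?r\<close> in blast)
    then show ?l by blast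
  next
    assume l: ?l
    have "?Q j" if "j < ?n" for j by (rule l[rule_format]) (use that in simp)
    moreover have "?Q (?n + j)" if "j < length Bs" for j by (rule l[rule_format]) (use that in simp)
    ultimately show ?r by blast
  qed
  have "(\<forall>j<?n. ?Q j) \<longleftrightarrow> chain As (ys @ [x]) ks"
  proof -
    have "?Q j \<longleftrightarrow> ks ! j \<in> het \<O> ((ys @ [x]) ! j) (fobj (As ! j) ((ys @ [x]) ! Suc j))"
      if "j < ?n" for j
      using that assms by (auto simp: nth_append nth_Cons less_Suc_eq split: nat.splits)
    then show ?thesis using assms by (auto simp: chain_def objs_def args_def)
  qed
  moreover have "(\<forall>j<length Bs. ?Q (?n + j)) \<longleftrightarrow> chain Bs (x' # zs) ls"
  proof -
    have "?Q (?n + j) \<longleftrightarrow> ls ! j \<in> het \<O> ((x' # zs) ! j) (fobj (Bs ! j) ((x' # zs) ! Suc j))"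
      if "j < length Bs" for j
      using that assms by (auto simp: nth_append nth_Cons split: nat.splits)
    then show ?thesis using assms by (auto simp: chain_def objs_def args_def)
  qed
  ultimately show ?thesis using split by blast
qed

text \<open>Emptiness of the two parts selects the clause: both empty is the case without arguments,
  only \<open>As\<close> empty is naturality in the first object, only \<open>Bs\<close> empty is
  naturality in the last one, and neither empty is an intermediate object.\<close>

lemma extranatural_imp_natural:
  assumes "extranatural C \<O> P Ts H f"
  shows "natural P Ts H f"
  unfolding natural_def
proof (intro allI impI, elim conjE)
  fix As Bs ys x x' zs u ks ls
  assume Ts: "Ts = As @ Bs" and u: "u \<in> arr C x x'"
    and A: "chain As (ys @ [x]) ks" and B: "chain Bs (x' # zs) ls"
  note E = assms[unfolded extranatural_def Let_def]
  note E1 = E[THEN conjunct1, rule_format]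
  note E2 = E[THEN conjunct2, THEN conjunct1, rule_format]
  note E3 = E[THEN conjunct2, THEN conjunct2, THEN conjunct1, rule_format]
  note E4 = E[THEN conjunct2, THEN conjunct2, THEN conjunct2, rule_format]
  note len = chain_length[OF A] chain_length[OF B]
  note ob = chain_objs[OF A] chain_objs[OF B]
  show "slide_left P H f As ys x x' zs u ks ls = slide_right P H f Bs ys x x' zs u ks ls"
  proof (cases As rule: rev_cases)
    case Nil
    show ?thesis
    proof (cases Bs)
      case Nil
      with \<open>As = []\<close> Ts A B u show ?thesis
        by (auto simp: slide_left_def slide_right_def intro!: E4)
    next
      case (Cons B' Bs')
      with B obtain z zs' l ls' where *: "zs = z # zs'" "ls = l # ls'" by (auto elim: chain_ConsE)
      have "f ((x' # zs)[0 := x]) (ls[0 := lact \<O> x ((x' # zs) ! 0) (fobj (Ts ! 0) ((x' # zs) ! 1)) u (ls ! 0)])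
        = lact P x ((x' # zs) ! 0) (fobj H ((x' # zs) ! length Ts)) u (f (x' # zs) ls)"
        using \<open>As = []\<close> Cons Ts A B u ob by (intro E3) (auto simp: chain_def)
      moreover have "(x' # zs) ! length Ts = last (x' # zs)"
        using len \<open>As = []\<close> Ts by (subst last_conv_nth) auto
      ultimately show ?thesis using \<open>As = []\<close> Cons Ts * len
        by (simp add: slide_left_def slide_right_def act_first_def)
    qed
  next
    case (snoc As' A')
    from A obtain ys' y ks' k where *: "ys = ys' @ [y]" "ks = ks' @ [k]" "length ys' = length As'"
      unfolding snoc by (elim chain_revE)
    then have lk: "length ks' = length As'" using len snoc by simp
    show ?thesis
    proof (cases Bs)
      case Nil
      let ?n = "length Ts"
      have [simp]: "zs = []" "ls = []" using Nil B by auto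
      have "f ((ys @ [x])[?n := x'])
          (ks[?n - 1 := ract \<O> ((ys @ [x]) ! (?n - 1)) (fobj (Ts ! (?n - 1)) ((ys @ [x]) ! ?n)) (fobj (Ts ! (?n - 1)) x')
                         (ks ! (?n - 1)) (farr (Ts ! (?n - 1)) ((ys @ [x]) ! ?n) x' u)])
        = ract P ((ys @ [x]) ! 0) (fobj H ((ys @ [x]) ! ?n)) (fobj H x') (f (ys @ [x]) ks) (farr H ((ys @ [x]) ! ?n) x' u)"
        using snoc Nil Ts A B u ob len by (intro E2) (auto simp: chain_def nth_append)
      moreover have "hd (ys @ [x]) = (ys @ [x]) ! 0" by (simp add: hd_conv_nth)
      ultimately show ?thesis unfolding slide_left_def slide_right_def using snoc Nil Ts * lk len
        by (simp add: act_last_def nth_append list_update_append)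
    next
      case (Cons B' Bs')
      with B obtain z zs' l ls' where **: "zs = z # zs'" "ls = l # ls'" by (auto elim: chain_ConsE)
      let ?xs = "ys @ x # zs" and ?ks = "ks @ ls" and ?i = "length As"
      have "f (?xs[?i := x'])
          (?ks[?i - 1 := ract \<O> (?xs ! (?i - 1)) (fobj (Ts ! (?i - 1)) (?xs ! ?i)) (fobj (Ts ! (?i - 1)) x')
                         (?ks ! (?i - 1)) (farr (Ts ! (?i - 1)) (?xs ! ?i) x' u)])
        = f ?xs (?ks[?i := lact \<O> (?xs ! ?i) x' (fobj (Ts ! ?i) (?xs ! Suc ?i)) u (?ks ! ?i)])"
        by (rule E1, intro conjI)
          (use snoc Cons Ts A B u ob len intermediate_args_iff[of ys As zs Bs ks ls x x'] in
            \<open>auto simp: objs_def nth_append\<close>)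
      then show ?thesis using snoc Cons Ts * ** lk len
        by (simp add: slide_left_def slide_right_def act_last_def act_first_def
            nth_append list_update_append)
    qed
  qed
qed

lemma natural_imp_extranatural:
  assumes nat: "natural P Ts H f"
  shows "extranatural C \<O> P Ts H f"
proof -
  let ?n = "length Ts"
  have N: "slide_left P H f As ys x x' zs u ks ls = slide_right P H f Bs ys x x' zs u ks ls"
    if "Ts = As @ Bs" "u \<in> arr C x x'" "chain As (ys @ [x]) ks" "chain Bs (x' # zs) ls"
    for As Bs ys x x' zs u ks ls
    using nat that unfolding natural_def by blast
  have E1: "f (xs[i := x'])
          (ks[i - 1 := ract \<O> (xs ! (i - 1)) (fobj (Ts ! (i - 1)) (xs ! i)) (fobj (Ts ! (i - 1)) x')
                         (ks ! (i - 1)) (farr (Ts ! (i - 1)) (xs ! i) x' u)])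
        = f xs (ks[i := lact \<O> (xs ! i) x' (fobj (Ts ! i) (xs ! Suc i)) u (ks ! i)])"
    if i: "0 < i" "i < ?n" and xs: "xs \<in> objs C (Suc ?n)" and x': "x' \<in> obj C"
      and u: "u \<in> arr C (xs ! i) x'" and "length ks = ?n"
      and ty: "\<forall>j<?n. ks ! j \<in> het \<O> (if j = i then x' else xs ! j) (fobj (Ts ! j) (xs ! Suc j))"
    for i xs x' u ks
  proof -
    \<comment> \<open>An intermediate index has a functor \<open>A\<close> just before it and a
      functor \<open>B\<close> at it. This leaves \<open>p\<close> functors before and
      \<open>q\<close> after, and three objects \<open>y\<close>, \<open>x\<close>, \<open>z\<close>
      around the cut.\<close>
    from i obtain p q where pq: "i = Suc p" "?n = p + Suc (Suc q)"
      by (metis Suc_pred add_Suc add_Suc_right less_imp_Suc_add)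
    have app: "\<exists>ys zs. xs = ys @ zs \<and> length ys = m \<and> length zs = k" if "length xs = m + k"
      for xs :: "'z list" and m k
      using that by (intro exI[of _ "take m xs"] exI[of _ "drop m xs"]) simp
    obtain As' A B Bs' where Ts: "Ts = As' @ A # B # Bs'" "length As' = p" "length Bs' = q"
      using app[OF pq(2)] by (auto simp: length_Suc_conv)
    obtain ys y x z zs where X: "xs = ys @ y # x # z # zs" "length ys = p" "length zs = q"
    proof -
      obtain ys zs where "xs = ys @ zs" "length ys = p" "length zs = Suc (Suc (Suc q))"
        using app[of xs p "Suc (Suc (Suc q))"] xs pq by (auto simp: objs_def)
      then show ?thesis using that by (auto simp: length_Suc_conv)
    qed
    obtain ks' k l ls where K: "ks = ks' @ k # l # ls" "length ks' = p" "length ls = q"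
    proof -
      obtain ys zs where "ks = ys @ zs" "length ys = p" "length zs = Suc (Suc q)"
        using app[of ks p "Suc (Suc q)"] \<open>length ks = ?n\<close> pq by auto
      then show ?thesis using that by (auto simp: length_Suc_conv)
    qed
    have "chain (As' @ [A]) ((ys @ [y]) @ [x]) (ks' @ [k]) \<and> chain (B # Bs') (x' # z # zs) (l # ls)"
    proof (rule iffD1[OF intermediate_args_iff])
      show "\<forall>j<length ((As' @ [A]) @ B # Bs'). ((ks' @ [k]) @ l # ls) ! j
          \<in> het \<O> (if j = length (As' @ [A]) then x' else ((ys @ [y]) @ x # z # zs) ! j)
            (fobj (((As' @ [A]) @ B # Bs') ! j) (((ys @ [y]) @ x # z # zs) ! Suc j))"
        using ty by (simp add: pq Ts X K split del: if_split cong: if_cong)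
    qed (use xs x' Ts X K in \<open>auto simp: objs_def\<close>)
    then have "slide_left P H f (As' @ [A]) (ys @ [y]) x x' (z # zs) u (ks' @ [k]) (l # ls)
      = slide_right P H f (B # Bs') (ys @ [y]) x x' (z # zs) u (ks' @ [k]) (l # ls)"
      using u Ts X pq by (intro N) (auto simp: nth_append)
    then show ?thesis using Ts X K pq
      by (simp add: slide_left_def slide_right_def act_last_def act_first_def
          nth_append list_update_append)
  qed
  have E2: "f (xs[?n := x'])
          (ks[?n - 1 := ract \<O> (xs ! (?n - 1)) (fobj (Ts ! (?n - 1)) (xs ! ?n)) (fobj (Ts ! (?n - 1)) x')
                         (ks ! (?n - 1)) (farr (Ts ! (?n - 1)) (xs ! ?n) x' u)])
        = ract P (xs ! 0) (fobj H (xs ! ?n)) (fobj H x') (f xs ks) (farr H (xs ! ?n) x' u)"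
    if n: "0 < ?n" and xs: "xs \<in> objs C (Suc ?n)" and x': "x' \<in> obj C"
      and u: "u \<in> arr C (xs ! ?n) x'" and ks: "ks \<in> args \<O> Ts xs"
    for xs x' u ks
  proof -
    obtain As A where Ts: "Ts = As @ [A]" using n by (cases Ts rule: rev_cases) auto
    from xs ks have ch: "chain Ts xs ks" by (simp add: chain_def)
    from chain_length[OF this] obtain ys y x ks' k where X: "xs = (ys @ [y]) @ [x]" "ks = ks' @ [k]"
      "length ys = length As" "length ks' = length As"
      unfolding Ts by (auto simp: length_Suc_conv_rev)
    have "slide_left P H f Ts (ys @ [y]) x x' [] u ks [] = slide_right P H f [] (ys @ [y]) x x' [] u ks []"
      by (rule N) (use u Ts X ch x' in \<open>auto simp: nth_append\<close>)
    moreover have "hd (ys @ [y, x]) = (ys @ [y, x]) ! 0" by (simp add: hd_conv_nth)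
    ultimately show ?thesis using Ts X
      by (simp add: slide_left_def slide_right_def act_last_def nth_append list_update_append)
  qed
  have E3: "f (xs[0 := x]) (ks[0 := lact \<O> x (xs ! 0) (fobj (Ts ! 0) (xs ! 1)) u (ks ! 0)])
        = lact P x (xs ! 0) (fobj H (xs ! ?n)) u (f xs ks)"
    if n: "0 < ?n" and xs: "xs \<in> objs C (Suc ?n)" and x: "x \<in> obj C"
      and u: "u \<in> arr C x (xs ! 0)" and ks: "ks \<in> args \<O> Ts xs"
    for xs x u ks
  proof -
    obtain B Bs where Ts: "Ts = B # Bs" using n by (cases Ts) auto
    from xs ks have ch: "chain Ts xs ks" by (simp add: chain_def)
    then obtain x' z zs k ls where X: "xs = x' # z # zs" "ks = k # ls"
      unfolding Ts by (elim chain_ConsE)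
    have "slide_left P H f [] [] x x' (z # zs) u [] ks = slide_right P H f Ts [] x x' (z # zs) u [] ks"
      by (rule N) (use u Ts X ch x in auto)
    moreover have "xs ! ?n = last xs"
      using chain_length(1)[OF ch] chain_hd_last(1)[OF ch] by (simp add: last_conv_nth)
    ultimately show ?thesis using Ts X
      by (simp add: slide_left_def slide_right_def act_first_def)
  qed
  have E4: "lact P x x' (fobj H x') u (f [x'] []) = ract P x (fobj H x) (fobj H x') (f [x] []) (farr H x x' u)"
    if "?n = 0" "x \<in> obj C" "x' \<in> obj C" "u \<in> arr C x x'" for x x' u
    using N[of "[]" "[]" u x x' "[]" "[]" "[]" "[]"] that by (simp add: slide_left_def slide_right_def)
  show ?thesis unfolding extranatural_def Let_def
    by (intro conjI allI impI ballI) ((elim conjE)?, (rule E1 E2 E3 E4; assumption))+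
qed

section \<open>Membership in \<open>families\<close>\<close>

lemma chain_nth:
  assumes "chain Ts xs ks"
  shows "xs ! 0 = hd xs" "xs ! length Ts = last xs"
  using chain_length(1)[OF assms] chain_hd_last(1)[OF assms]
  by (simp_all add: hd_conv_nth last_conv_nth)

lemma families_het:
  assumes "f \<in> families C \<O> P Ts H" "chain Ts xs ks"
  shows "f xs ks \<in> het P (hd xs) (fobj H (last xs))"
proof -
  have "f xs ks \<in> het P (xs ! 0) (fobj H (xs ! length Ts))"
    using assms by (auto simp: families_def chain_def dest!: PiE_mem)
  then show ?thesis by (simp add: chain_nth[OF assms(2)])
qed

text \<open>Members are already extensional. Through this, equalities proved between restricted
  families become equalities of the families themselves.\<close>

lemma fam_families:
  assumes "f \<in> families C \<O> P Ts H"
  shows "fam Ts f = f"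
proof -
  have "f \<in> (\<Pi>\<^sub>E xs\<in>objs C (Suc (length Ts)). args \<O> Ts xs \<rightarrow>\<^sub>E het P (xs ! 0) (fobj H (xs ! length Ts)))"
    using assms by (simp add: families_def)
  then show ?thesis unfolding fam_def
    by (intro ext) (auto simp: restrict_def PiE_iff extensional_def)
qed

lemma families_slide:
  assumes "f \<in> families C \<O> P (As @ Bs) H" "u \<in> arr C x x'"
    "chain As (ys @ [x]) ks" "chain Bs (x' # zs) ls"
  shows "slide_left P H f As ys x x' zs u ks ls = slide_right P H f Bs ys x x' zs u ks ls"
  using assms extranatural_imp_natural[of P "As @ Bs" H f] unfolding families_def natural_def by blast

lemma chain_append_hdI:
  assumes "chain As (ys @ [x]) ks" "chain Bs (x # zs) ls"
  shows "chain (As @ Bs) (ys @ x # zs) (ks @ ls)"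
  using assms chain_length[OF assms(1)] by (simp add: chain_append)

lemma act_last_snoc [simp]:
  "act_last (As @ [A]) (ys @ [y]) x x' u (ks @ [k])
    = ks @ [ract \<O> y (fobj A x) (fobj A x') k (farr A x x' u)]"
  by (simp add: act_last_def)

lemma act_first_Cons [simp]:
  "act_first (B # Bs) x x' (z # zs) u (k # ks) = lact \<O> x x' (fobj B z) u k # ks"
  by (simp add: act_first_def)

text \<open>\<open>Bs\<close> must be nonempty for the last argument to lie in it. The list
  \<open>ws\<close> omits the final object, so it is as long as \<open>Bs\<close>.\<close>

lemma act_last_append:
  assumes "Bs \<noteq> []" "length ws = length Bs" "length ls = length Bs"
  shows "act_last (As @ Bs) (ys @ ws) x x' u (ks @ ls) = ks @ act_last Bs ws x x' u ls"
  using assms by (cases ws; cases ls) (auto simp: act_last_def butlast_append)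

lemma act_first_append:
  assumes "Bs \<noteq> []" "length zs = length Bs" "length ls = length Bs"
  shows "act_first (Bs @ Cs) x x' (zs @ ws) u (ls @ ms) = act_first Bs x x' zs u ls @ ms"
  using assms by (cases zs; cases ls) (auto simp: act_first_def)

lemma chain_act_last:
  assumes "chain As (ys @ [x]) ks" "As \<noteq> []" "set As \<subseteq> functors C D" "x' \<in> obj C" "u \<in> arr C x x'"
  shows "chain As (ys @ [x']) (act_last As ys x x' u ks)"
proof -
  obtain As' A where As: "As = As' @ [A]" using assms(2) by (cases As rule: rev_cases) auto
  have A: "A \<in> functors C D" using assms(3) As by simp
  from assms(1) obtain ys' y ks' k where *: "ys = ys' @ [y]" "ks = ks' @ [k]" "length ys' = length As'"
    "chain As' (ys' @ [y]) ks'" "x \<in> obj C" "y \<in> obj C" "k \<in> het \<O> y (fobj A x)"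
    unfolding As by (rule chain_revE)
  then show ?thesis using A assms by (simp add: As chain_rev ract_closed functorsD)
qed

lemma chain_act_first:
  assumes "chain Bs (x' # zs) ls" "Bs \<noteq> []" "set Bs \<subseteq> functors C D" "x \<in> obj C" "u \<in> arr C x x'"
  shows "chain Bs (x # zs) (act_first Bs x x' zs u ls)"
proof -
  obtain B Bs' where Bs: "Bs = B # Bs'" using assms(2) by (cases Bs) auto
  have B: "B \<in> functors C D" using assms(3) Bs by simp
  from assms(1) obtain z zs' l ls' where *: "zs = z # zs'" "ls = l # ls'" "x' \<in> obj C" "z \<in> obj C"
    "l \<in> het \<O> x' (fobj B z)" "chain Bs' (z # zs') ls'"
    unfolding Bs by (auto elim: chain_ConsE)
  then show ?thesis using B assms by (simp add: Bs chain_Cons lact_closed functorsD)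
qed

text \<open>Acting by \<open>u\<close> on the last or first argument turns a chain ending at
  \<open>x\<close> into one ending at \<open>x'\<close>, and one starting at \<open>x'\<close> into
  one starting at \<open>x\<close>. Hence both sides of the equation only evaluate the family at
  chains, where the restriction is invisible and the raw function \<open>h\<close> can be
  used.\<close>

lemma fam_familiesI:
  assumes Ts: "set Ts \<subseteq> functors C D"
    and het: "\<And>xs ks. chain Ts xs ks \<Longrightarrow> h xs ks \<in> het P (hd xs) (fobj H (last xs))"
    and nat: "\<And>As Bs ys x x' zs u ks ls. \<lbrakk>Ts = As @ Bs; u \<in> arr C x x'; x \<in> obj C; x' \<in> obj C;
        chain As (ys @ [x]) ks; chain Bs (x' # zs) ls\<rbrakk> \<Longrightarrow>
        slide_left P H h As ys x x' zs u ks ls = slide_right P H h Bs ys x x' zs u ks ls"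
  shows "fam Ts h \<in> families C \<O> P Ts H"
proof -
  have "natural P Ts H (fam Ts h)"
    unfolding natural_def
  proof (intro allI impI, elim conjE)
    fix As Bs ys x x' zs u ks ls
    assume *: "Ts = As @ Bs" "u \<in> arr C x x'" and A: "chain As (ys @ [x]) ks" and B: "chain Bs (x' # zs) ls"
    have x: "x \<in> obj C" "x' \<in> obj C" using chain_objs[OF A] chain_objs[OF B] by auto
    have "slide_left P H (fam Ts h) As ys x x' zs u ks ls = slide_left P H h As ys x x' zs u ks ls"
      using chain_append_hdI[OF chain_act_last[OF A] B] B * x Ts
      by (simp add: slide_left_def fam_apply)
    moreover have "slide_right P H (fam Ts h) Bs ys x x' zs u ks ls = slide_right P H h Bs ys x x' zs u ks ls"
      using chain_append_hdI[OF A chain_act_first[OF B]] A * x Ts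
      by (simp add: slide_right_def fam_apply)
    ultimately show "slide_left P H (fam Ts h) As ys x x' zs u ks ls
        = slide_right P H (fam Ts h) Bs ys x x' zs u ks ls"
      using nat[OF * x A B] by simp
  qed
  moreover have "fam Ts h \<in> (\<Pi>\<^sub>E xs\<in>objs C (Suc (length Ts)).
      args \<O> Ts xs \<rightarrow>\<^sub>E het P (xs ! 0) (fobj H (xs ! length Ts)))"
  proof -
    have "h xs ks \<in> het P (xs ! 0) (fobj H (xs ! length Ts))"
      if "xs \<in> objs C (Suc (length Ts))" "ks \<in> args \<O> Ts xs" for xs ks
    proof -
      have ch: "chain Ts xs ks" using that by (simp add: chain_def)
      with het[OF ch] show ?thesis by (simp add: chain_nth)
    qed
    then show ?thesis by (auto simp: fam_def)
  qed
  ultimately show ?thesis by (simp add: families_def natural_imp_extranatural)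
qed

subsection \<open>Substitution\<close>

text \<open>The objects \<open>ws\<close> read by \<open>f\<close> shrink to their two ends. For
  \<open>q = 0\<close> these ends coincide, and the single object is passed to \<open>g\<close>
  twice.\<close>

lemma subst_at_append:
  assumes "length ys = p" "length ks = p" "length ws = Suc q" "length ls = q"
  shows "subst_at p q g f (ys @ ws @ zs) (ks @ ls @ ms)
    = g (ys @ hd ws # last ws # zs) (ks @ f ws ls # ms)"
proof -
  have "drop q ws = [last ws]" using assms
    by (metis Suc_n_not_le_n append_butlast_last_id append_eq_conv_conj diff_Suc_1 length_butlast list.size(3) not_less_eq_eq zero_le)
  moreover have "take (Suc 0) ws = [hd ws]" using assms by (cases ws) auto
  ultimately show ?thesis using assms by (simp add: subst_at_def take_Suc)
qed

text \<open>An arrow acting strictly inside \<open>As\<close> or \<open>Cs\<close> leaves the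
  arguments of \<open>f\<close> alone, so the equation is that of \<open>g\<close>. An arrow acting
  inside \<open>Bs\<close> or at one of its ends is handled by the equation of \<open>f\<close>,
  with that of \<open>g\<close> at each end that is reached. When \<open>Bs\<close> is empty both
  ends are reached at once.\<close>

lemma subst_families:
  assumes P: "bimodule C D P"
    and obs: "set As \<subseteq> functors C D" "set Bs \<subseteq> functors C D" "set Cs \<subseteq> functors C D"
      "X \<in> functors C D" "Y \<in> functors C D"
    and g: "g \<in> families C \<O> P (As @ X # Cs) Y" and f: "f \<in> families C \<O> \<O> Bs X"
  shows "fam (As @ Bs @ Cs) (subst_at (length As) (length Bs) g f) \<in> families C \<O> P (As @ Bs @ Cs) Y"
proof (rule fam_familiesI)
  let ?s = "subst_at (length As) (length Bs) g f"
  have chain_g: "chain (As @ X # Cs) (ys @ hd ws # last ws # zs) (ks @ f ws ls # ms)"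
    if "chain As (ys @ [hd ws]) ks" "chain Bs ws ls" "chain Cs (last ws # zs) ms" for ys ws zs ks ls ms
    using that families_het[OF f that(2)] chain_hd_last[OF that(2)]
    by (auto intro!: chain_append_hdI simp: chain_Cons)
  show "?s xs ks \<in> het P (hd xs) (fobj Y (last xs))" if "chain (As @ Bs @ Cs) xs ks" for xs ks
    using that
  proof (rule chain_split3E)
    fix ys ws zs ks1 ks2 ks3
    assume *: "xs = ys @ ws @ zs" "ks = ks1 @ ks2 @ ks3" "length ys = length As" "length ks1 = length As"
      "length ws = Suc (length Bs)" "length ks2 = length Bs"
      and ch: "chain As (ys @ [hd ws]) ks1" "chain Bs ws ks2" "chain Cs (last ws # zs) ks3"
    have ws: "ws \<noteq> []" using *(5) by auto
    have "hd (ys @ hd ws # last ws # zs) = hd xs" "last (ys @ hd ws # last ws # zs) = last xs"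
      using ws * by (auto simp: hd_append)
    then show ?thesis using families_het[OF g chain_g[OF ch]] * by (simp add: subst_at_append)
  qed
  fix L R ys x x' zs u ks ls
  assume LR: "As @ Bs @ Cs = L @ R" and u: "u \<in> arr C x x'" and x: "x \<in> obj C" "x' \<in> obj C"
    and L: "chain L (ys @ [x]) ks" and R: "chain R (x' # zs) ls"
  \<comment> \<open>Requiring \<open>A\<close> and \<open>C'\<close> to be nonempty assigns both
    ends of \<open>Bs\<close> to the middle case.\<close>
  consider A where "As = L @ A" "R = A @ Bs @ Cs" "A \<noteq> []"
    | B B' where "L = As @ B" "R = B' @ Cs" "Bs = B @ B'"
    | C' where "Cs = C' @ R" "L = As @ Bs @ C'" "C' \<noteq> []"
    using LR by (auto simp: append_eq_append_conv2) (metis append.right_neutral append_Nil)+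
  then show "slide_left P Y ?s L ys x x' zs u ks ls = slide_right P Y ?s R ys x x' zs u ks ls"
  proof cases
    case 1
    from R obtain y2 ws z3 l1 l2 l3 where *: "x' # zs = y2 @ ws @ z3" "ls = l1 @ l2 @ l3"
        "length y2 = length A" "length l1 = length A" "length ws = Suc (length Bs)" "length l2 = length Bs"
        "chain A (y2 @ [hd ws]) l1" "chain Bs ws l2" "chain Cs (last ws # z3) l3"
      unfolding 1 by (rule chain_split3E)
    then obtain y2' where y2: "y2 = x' # y2'" "zs = y2' @ ws @ z3" using 1 by (cases y2) auto
    have ws: "ws \<noteq> []" using * by auto
    \<comment> \<open>These are the objects and arguments that \<open>g\<close> receives from the
      right part once \<open>f\<close> is evaluated. Since \<open>u\<close> acts before the block
      \<open>ws\<close>, the value of \<open>f\<close> is the same on both sides and is carried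
      along as an ordinary argument.\<close>
    let ?gz = "y2' @ hd ws # last ws # z3" and ?gl = "l1 @ f ws l2 # l3"
    have act_len: "length (act_last L ys x x' u ks) = length L"
      using chain_length[OF L] by (simp add: act_last_def)
    have ws': "hd ws # tl ws @ z3 = ws @ z3" using ws by simp
    have actf: "act_first (A @ Bs @ Cs) x x' (y2' @ ws @ z3) u (l1 @ l2 @ l3)
        = act_first A x x' (y2' @ [hd ws]) u l1 @ l2 @ l3"
      using act_first_append[of A "y2' @ [hd ws]" l1 "Bs @ Cs" x x' "tl ws @ z3" u "l2 @ l3"] * 1 y2
      unfolding append_assoc append_Cons append_Nil ws' by simp
    have actf_len: "length (act_first A x x' (y2' @ [hd ws]) u l1) = length A"
      using * 1 by (cases l1) (auto simp: act_first_def)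
    have "slide_left P Y ?s L ys x x' zs u ks ls = slide_left P Y g L ys x x' ?gz u ks ?gl"
      using subst_at_append[of "x' # y2'" "length As" l1 ws "length Bs" l2 g f z3 l3]
        subst_at_append[of "ys @ x' # y2'" "length As" "act_last L ys x x' u ks @ l1" ws "length Bs" l2 g f z3 l3]
        * 1 y2 ws act_len chain_length[OF L]
      by (auto simp: slide_left_def)
    also have "\<dots> = slide_right P Y g (A @ X # Cs) ys x x' ?gz u ks ?gl"
      by (rule families_slide) (use g 1 u L R y2 * chain_g in
          \<open>auto intro!: chain_append_hdI[of _ "x' # y2'", simplified] simp: chain_Cons
            families_het[OF f] chain_hd_last\<close>)
    also have "\<dots> = slide_right P Y ?s R ys x x' zs u ks ls"
      using subst_at_append[of "ys @ x # y2'" "length As" "ks @ act_first A x x' (y2' @ [hd ws]) u l1" ws "length Bs" l2 g f z3 l3]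
        * 1 y2 ws actf actf_len chain_length[OF L]
        act_first_append[of A "y2' @ [hd ws]" l1 "X # Cs" x x' "last ws # z3" u "f ws l2 # l3"]
      by (simp add: slide_right_def)
    finally show ?thesis .
  next
    case 2
    \<comment> \<open>Both sides are \<open>g\<close> applied to the corresponding side of the equation for \<open>f\<close>; at an end of
      \<open>Bs\<close>, the action on the value of \<open>f\<close> is moved across by the naturality of \<open>g\<close>.\<close>
    from L obtain ya v vb ka kb where a: "ys @ [x] = ya @ v # vb" "ks = ka @ kb"
      "length ya = length As" "chain As (ya @ [v]) ka" "chain B (v # vb) kb"
      unfolding 2 by (rule chain_splitE)
    obtain wb where wb: "v # vb = wb @ [x]" "ys = ya @ wb"
      using a(1) by (metis append_eq_append_conv2 append_butlast_last_id butlast_append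
          last_appendR last_snoc butlast_snoc list.distinct(1))
    have v: "v = hd (wb @ [x])" using wb(1) by (metis list.sel(1))
    from R obtain wc v' zc lb lc where c: "x' # zs = wc @ v' # zc" "ls = lb @ lc"
      "length wc = length B'" "chain B' (wc @ [v']) lb" "chain Cs (v' # zc) lc"
      unfolding 2 by (rule chain_splitE)
    obtain wc' where wc: "wc @ [v'] = x' # wc'" "zs = wc' @ zc"
      using c(1) by (cases wc) auto
    have v': "v' = last (x' # wc')" using wc(1) by (metis last_snoc)
    have chB: "chain B (wb @ [x]) kb" and chB': "chain B' (x' # wc') lb"
      and chA: "chain As (ya @ [hd (wb @ [x])]) ka" and chC: "chain Cs (last (x' # wc') # zc) lc"
      using a c wb wc v v' by simp_all
    note len = chain_length[OF chB] chain_length[OF chB'] chain_length[OF chA] chain_length[OF chC]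
    have obs': "hd (wb @ [x]) \<in> obj C" "last (x' # wc') \<in> obj C"
      using chain_objs[OF chA] chain_objs[OF chC] by auto
    have "slide_left P Y ?s L ys x x' zs u ks ls
      = g (ya @ hd (wb @ [x]) # last (x' # wc') # zc) (ka @ slide_left \<O> X f B wb x x' wc' u kb lb # lc)"
    proof (cases "B = []")
      case False
      then have "wb \<noteq> []" using len by auto
      with False show ?thesis
        using subst_at_append[of ya "length As" ka "wb @ x' # wc'" "length Bs" "act_last B wb x x' u kb @ lb" g f zc lc]
          len 2 wb wc a c chain_length[OF chain_act_last[OF chB]] obs u x
        by (simp add: slide_left_def act_last_append hd_append)
    next
      case True
      then have [simp]: "wb = []" "kb = []" using chB by auto
      have "slide_left P Y ?s L ys x x' zs u ks ls
          = slide_left P Y g As ya x x' (last (x' # wc') # zc) u ka (f (x' # wc') lb # lc)"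
        using subst_at_append[of "[]" "length As" "[]" "x' # wc'" "length Bs" lb g f zc lc]
          subst_at_append[of ya "length As" "act_last As ya x x' u ka" "x' # wc'" "length Bs" lb g f zc lc]
          len 2 wb wc a c chain_length[OF chain_act_last[OF chA]] obs u x True
        by (auto simp: slide_left_def)
      also have "\<dots> = slide_right P Y g (X # Cs) ya x x' (last (x' # wc') # zc) u ka (f (x' # wc') lb # lc)"
        by (rule families_slide) (use g u chA chC chB' x 2 True families_het[OF f, of "x' # wc'" lb] in
            \<open>auto simp: chain_Cons\<close>)
      finally show ?thesis using True by (simp add: slide_left_def slide_right_def)
    qed
    also have "slide_left \<O> X f B wb x x' wc' u kb lb = slide_right \<O> X f B' wb x x' wc' u kb lb"
      using f 2 u chB chB' by (intro families_slide) auto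
    also have "g (ya @ hd (wb @ [x]) # last (x' # wc') # zc) (ka @ slide_right \<O> X f B' wb x x' wc' u kb lb # lc)
      = slide_right P Y ?s R ys x x' zs u ks ls"
    proof (cases "B' = []")
      case False
      then show ?thesis
        using subst_at_append[of ya "length As" ka "wb @ x # wc'" "length Bs" "kb @ act_first B' x x' wc' u lb" g f zc lc]
          len 2 wb wc a c chain_length[OF chain_act_first[OF chB']] obs u x
        by (auto simp: slide_right_def act_first_append hd_append)
    next
      case True
      then have [simp]: "wc' = []" "lb = []" using chB' by auto
      have "slide_left P Y g (As @ [X]) (ya @ [hd (wb @ [x])]) x x' zc u (ka @ [f (wb @ [x]) kb]) lc
        = slide_right P Y g Cs (ya @ [hd (wb @ [x])]) x x' zc u (ka @ [f (wb @ [x]) kb]) lc"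
        by (rule families_slide) (use g u chA chC chB x 2 True families_het[OF f, of "wb @ [x]" kb] len in
            \<open>auto simp: chain_rev\<close>)
      also have "\<dots> = slide_right P Y ?s R ys x x' zs u ks ls"
        using subst_at_append[of ya "length As" ka "wb @ [x]" "length Bs" kb g f "[]" "[]"]
          subst_at_append[of ya "length As" ka "wb @ [x]" "length Bs" kb g f zc "act_first Cs x x' zc u lc"]
          len 2 wb wc a c chain_length[OF chain_act_first[OF chC]] obs u x True
        by (auto simp: slide_right_def hd_append)
      finally show ?thesis using True by (simp add: slide_left_def slide_right_def)
    qed
    finally show ?thesis .
  next
    case 3
    from L obtain ya ws zc k1 k2 k3 where *: "ys @ [x] = ya @ ws @ zc" "ks = k1 @ k2 @ k3"
        "length ya = length As" "length k1 = length As" "length ws = Suc (length Bs)" "length k2 = length Bs"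
        "length zc = length C'" "length k3 = length C'"
        "chain As (ya @ [hd ws]) k1" "chain Bs ws k2" "chain C' (last ws # zc) k3"
      unfolding 3 by (rule chain_split3E)
    then obtain zc' where zc: "zc = zc' @ [x]" "ys = ya @ ws @ zc'"
      using 3 by (cases zc rule: rev_cases) (auto simp flip: append_assoc)
    have ws: "ws \<noteq> []" using * by auto
    \<comment> \<open>Mirror image of the first case: \<open>u\<close> acts beyond the block
      \<open>ws\<close>, so \<open>f ws k2\<close> is again unchanged.\<close>
    let ?gy = "ya @ hd ws # last ws # zc'" and ?gk = "k1 @ f ws k2 # k3"
    have act_len: "length (act_last C' (last ws # zc') x x' u k3) = length C'"
      using * 3 by (simp add: act_last_def)
    have wsb: "butlast ws @ last ws # zc' = ws @ zc'"
      using append_butlast_last_id[OF ws] by (metis append_assoc append_Cons append_Nil)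
    have actl: "act_last (As @ Bs @ C') (ya @ ws @ zc') x x' u (k1 @ k2 @ k3)
        = k1 @ k2 @ act_last C' (last ws # zc') x x' u k3"
      using act_last_append[of C' "last ws # zc'" k3 "As @ Bs" "ya @ butlast ws" x x' u "k1 @ k2"] * 3 zc
      unfolding append_assoc wsb by simp
    have "slide_left P Y ?s L ys x x' zs u ks ls = slide_left P Y g (As @ X # C') ?gy x x' zs u ?gk ls"
      using subst_at_append[of ya "length As" k1 ws "length Bs" k2 g f "zc' @ x' # zs" "act_last C' (last ws # zc') x x' u k3 @ ls"]
        * 3 zc ws act_len actl
        act_last_append[of C' "last ws # zc'" k3 "As @ [X]" "ya @ [hd ws]" x x' u "k1 @ [f ws k2]"]
      by (simp add: slide_left_def)
    also have "\<dots> = slide_right P Y g R ?gy x x' zs u ?gk ls"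
      by (rule families_slide) (use g 3 u R zc * in
          \<open>auto intro!: chain_append_hdI simp: chain_Cons families_het[OF f] chain_hd_last\<close>)
    also have "\<dots> = slide_right P Y ?s R ys x x' zs u ks ls"
      using subst_at_append[of ya "length As" k1 ws "length Bs" k2 g f "zc' @ x # zs" "k3 @ act_first R x x' zs u ls"]
        subst_at_append[of ya "length As" k1 ws "length Bs" k2 g f "zc' @ [x]" k3]
        * 3 zc ws
      by (auto simp: slide_right_def hd_append)
    finally show ?thesis .
  qed
qed (use obs in auto)

subsection \<open>Composition with a tight family\<close>

text \<open>
  Taking \<open>P\<close> to be a companion gives \<open>compB\<close>; taking \<open>P = \<O>\<close> and \<open>f\<close> the identity loose family
  gives loosening.
\<close>

definition post_at :: "('c, 'ca, 'd, 'da, 'p) bimodule \<Rightarrow> ('c, 'ca, 'd, 'da) cfunctor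
    \<Rightarrow> ('c, 'ca, 'd, 'da) cfunctor \<Rightarrow> nat \<Rightarrow> ('c list \<Rightarrow> 'm list \<Rightarrow> 'p)
    \<Rightarrow> ('c list \<Rightarrow> 'm list \<Rightarrow> 'da) \<Rightarrow> 'c list \<Rightarrow> 'm list \<Rightarrow> 'p" where
  "post_at P X Y p f g xs ks = ract P (hd xs) (fobj X (xs ! p)) (fobj Y (last xs))
     (f (take (Suc p) xs) (take p ks)) (g (drop p xs) (drop p ks))"

lemma post_at_append:
  assumes "length ys = p" "length ks = p"
  shows "post_at P X Y p f g (ys @ x # zs) (ks @ ls)
    = ract P (hd (ys @ [x])) (fobj X x) (fobj Y (last (x # zs))) (f (ys @ [x]) ks) (g (x # zs) ls)"
  using assms by (auto simp: post_at_def hd_append nth_append)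

lemma het_companion [simp]: "het (companion D S) x y = arr D (fobj S x) y"
  and lact_companion [simp]:
    "lact (companion D S) x' x y u a = cmp D (fobj S x') (fobj S x) y (farr S x' x u) a"
  and ract_companion [simp]: "ract (companion D S) x y y' a b = cmp D (fobj S x) y y' a b"
  by (simp_all add: companion_def)

text \<open>Inside \<open>As\<close> or \<open>Bs\<close> the equation comes from \<open>f\<close>
  or \<open>g\<close> alone. At the joint, naturality of \<open>f\<close> in its last object
  produces \<open>farr X x x' u\<close> on the right of its value; associativity hands this arrow to
  \<open>g\<close>, where it is the left action of \<open>companion D X\<close>, and naturality of
  \<open>g\<close> in its first object applies.\<close>

lemma post_families:
  assumes P: "bimodule C D P"
    and obs: "set As \<subseteq> functors C D" "set Bs \<subseteq> functors C D" "X \<in> functors C D" "Y \<in> functors C D"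
    and f: "f \<in> families C \<O> P As X" and g: "g \<in> families C \<O> (companion D X) Bs Y"
  shows "fam (As @ Bs) (post_at P X Y (length As) f g) \<in> families C \<O> P (As @ Bs) Y"
proof (rule fam_familiesI)
  let ?h = "post_at P X Y (length As) f g"
  interpret P: bimodule C D P by (rule P)
  note X = functorsD[OF obs(3)] and Y = functorsD[OF obs(4)]
  note fh = families_het[OF f] and gh = families_het[OF g, simplified]
  show "?h xs ks \<in> het P (hd xs) (fobj Y (last xs))" if "chain (As @ Bs) xs ks" for xs ks
    using that
  proof (rule chain_splitE)
    fix ys x zs ks1 ks2
    assume *: "xs = ys @ x # zs" "ks = ks1 @ ks2" "length ys = length As"
      "chain As (ys @ [x]) ks1" "chain Bs (x # zs) ks2"
    then have "hd xs = hd (ys @ [x])" by (simp add: hd_append)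
    then show ?thesis
      using * fh[OF *(4)] gh[OF *(5)] chain_length[OF *(4)] chain_hd_last[OF *(4)] chain_hd_last[OF *(5)] X Y
      by (simp add: post_at_append P.ract_closed)
  qed
  fix L R ys x x' zs u ks ls
  assume LR: "As @ Bs = L @ R" and u: "u \<in> arr C x x'" and x: "x \<in> obj C" "x' \<in> obj C"
    and L: "chain L (ys @ [x]) ks" and R: "chain R (x' # zs) ls"
  note lenL = chain_length[OF L] and lenR = chain_length[OF R]
  consider "As = L" "R = Bs" | A where "As = L @ A" "R = A @ Bs" "A \<noteq> []"
    | B where "L = As @ B" "Bs = B @ R" "B \<noteq> []"
    using LR by (auto simp: append_eq_append_conv2)
  then show "slide_left P Y ?h L ys x x' zs u ks ls = slide_right P Y ?h R ys x x' zs u ks ls"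
  proof cases
    case 1
    have chA: "chain As (ys @ [x]) ks" and chB: "chain Bs (x' # zs) ls" using 1 L R by auto
    have fu: "slide_left P X f As ys x x' [] u ks [] = slide_right P X f [] ys x x' [] u ks []"
      using f u chA x by (intro families_slide) auto
    have gu: "slide_left (companion D X) Y g [] [] x x' zs u [] ls
        = slide_right (companion D X) Y g Bs [] x x' zs u [] ls"
      using g u chB x by (intro families_slide) auto
    have ob: "hd (ys @ [x]) \<in> obj C" "last (x' # zs) \<in> obj C"
      using chain_hd_last[OF chA] chain_hd_last[OF chB] by auto
    have "slide_left P Y ?h L ys x x' zs u ks ls
      = ract P (hd (ys @ [x])) (fobj X x') (fobj Y (last (x' # zs)))
          (slide_left P X f As ys x x' [] u ks []) (g (x' # zs) ls)"
    proof (cases "As = []")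
      case True
      with chA have "ys = []" "ks = []" by auto
      with True 1 show ?thesis
        using post_at_append[of "[]" 0 "[]" P X Y f g x' zs ls] fh[of "[x']" "[]"] gh[OF chB] x u ob X Y
        by (simp add: slide_left_def P.lact_ract)
    next
      case False
      then show ?thesis
        using 1 post_at_append[of ys "length As" "act_last As ys x x' u ks" P X Y f g x' zs ls]
          lenL chain_length[OF chain_act_last[OF chA]] obs u x
        by (auto simp: slide_left_def hd_append)
    qed
    \<comment> \<open>Here \<open>ract_ract\<close> moves the arrow \<open>farr X x x' u\<close>
      from the value of \<open>f\<close> to that of \<open>g\<close>.\<close>
    also have "\<dots> = ract P (hd (ys @ [x])) (fobj X x) (fobj Y (last (x' # zs))) (f (ys @ [x]) ks)
        (slide_left (companion D X) Y g [] [] x x' zs u [] ls)"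
      unfolding fu using fh[OF chA] gh[OF chB] ob x u X Y
      by (simp add: slide_right_def slide_left_def P.ract_ract)
    also have "\<dots> = slide_right P Y ?h R ys x x' zs u ks ls"
    proof (cases "Bs = []")
      case True
      with chB have [simp]: "zs = []" "ls = []" by auto
      from True 1 show ?thesis unfolding gu
        using post_at_append[of ys "length As" ks P X Y f g x "[]" "[]"] lenL
          fh[OF chA] gh[of "[x]" "[]"] x u ob X Y
        by (simp add: slide_right_def P.ract_ract)
    next
      case False
      then have "last (x' # zs) = last (x # zs)" using lenR 1 by auto
      with False show ?thesis unfolding gu
        using 1 post_at_append[of ys "length As" ks P X Y f g x zs "act_first Bs x x' zs u ls"] lenL
        by (simp add: slide_right_def)
    qed
    finally show ?thesis .
  next
    case 2
    from R obtain ya v zb la lb where *: "x' # zs = ya @ v # zb" "ls = la @ lb" "length ya = length A"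
      "chain A (ya @ [v]) la" "chain Bs (v # zb) lb"
      unfolding 2 by (rule chain_splitE)
    then obtain ya' where ya: "ya = x' # ya'" "zs = ya' @ v # zb" using 2 by (cases ya) auto
    have fu: "slide_left P X f L ys x x' (ya' @ [v]) u ks la = slide_right P X f A ys x x' (ya' @ [v]) u ks la"
      using f u L 2 * ya by (intro families_slide) auto
    have la: "length la = length A" using * chain_length[OF *(4)] by simp
    have ob: "v \<in> obj C" "last (v # zb) \<in> obj C" using chain_hd_last[OF *(5)] by auto
    have "slide_left P Y ?h L ys x x' zs u ks ls
      = ract P (hd (ys @ [x])) (fobj X v) (fobj Y (last (v # zb)))
          (slide_left P X f L ys x x' (ya' @ [v]) u ks la) (g (v # zb) lb)"
    proof (cases "L = []")
      case True
      with L have "ys = []" "ks = []" by auto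
      with True 2 show ?thesis
        using post_at_append[of "x' # ya'" "length As" la P X Y f g v zb lb] * ya la
          fh[of "x' # ya' @ [v]" la] gh[OF *(5)] x u ob X Y
        by (simp add: slide_left_def P.lact_ract)
    next
      case False
      then show ?thesis
        using 2 post_at_append[of "ys @ x' # ya'" "length As" "act_last L ys x x' u ks @ la" P X Y f g v zb lb]
          * ya la lenL chain_length[OF chain_act_last[OF L]] obs u x
        by (auto simp: slide_left_def hd_append)
    qed
    also have "\<dots> = slide_right P Y ?h R ys x x' zs u ks ls"
      unfolding fu
      using 2 post_at_append[of "ys @ x # ya'" "length As" "ks @ act_first A x x' (ya' @ [v]) u la" P X Y f g v zb lb]
        * ya la lenL chain_length[OF chain_act_first[of A x' "ya' @ [v]" la x u]] obs u x
        act_first_append[of A "ya' @ [v]" la Bs x x' zb u lb]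
      by (auto simp: slide_right_def hd_append)
    finally show ?thesis .
  next
    case 3
    from L obtain ya v vb ka kb where *: "ys @ [x] = ya @ v # vb" "ks = ka @ kb"
      "length ya = length As" "chain As (ya @ [v]) ka" "chain B (v # vb) kb"
      unfolding 3 by (rule chain_splitE)
    then obtain vb' where vb: "vb = vb' @ [x]" "ys = ya @ v # vb'"
      using 3 chain_length[OF *(5)] by (cases vb rule: rev_cases) auto
    have gu: "slide_left (companion D X) Y g B (v # vb') x x' zs u kb ls
        = slide_right (companion D X) Y g R (v # vb') x x' zs u kb ls"
      using g u R 3 * vb by (intro families_slide) auto
    have len: "length ka = length As" "length kb = length B"
      using * chain_length[OF *(4)] chain_length[OF *(5)] by auto
    have ob: "hd (ya @ [v]) \<in> obj C" "v \<in> obj C"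
      using chain_hd_last[OF *(4)] chain_objs[OF *(5)] by auto
    have "slide_left P Y ?h L ys x x' zs u ks ls
      = ract P (hd (ya @ [v])) (fobj X v) (fobj Y (last (x' # zs))) (f (ya @ [v]) ka)
          (slide_left (companion D X) Y g B (v # vb') x x' zs u kb ls)"
      using 3 post_at_append[of ya "length As" ka P X Y f g v "vb' @ x' # zs" "act_last B (v # vb') x x' u kb @ ls"]
        * vb len act_last_append[of B "v # vb'" kb As ya x x' u ka] chain_length[OF *(5)]
      by (simp add: slide_left_def)
    also have "\<dots> = slide_right P Y ?h R ys x x' zs u ks ls"
    proof (cases "R = []")
      case True
      with R have [simp]: "zs = []" "ls = []" by auto
      from True 3 show ?thesis unfolding gu
        using post_at_append[of ya "length As" ka P X Y f g v "vb' @ [x]" kb] * vb len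
          fh[OF *(4)] gh[of "v # vb' @ [x]" kb] x u ob X Y
        by (simp add: slide_right_def P.ract_ract hd_append)
    next
      case False
      then have "last (x' # zs) = last (x # zs)" using lenR by auto
      with False show ?thesis unfolding gu
        using 3 post_at_append[of ya "length As" ka P X Y f g v "vb' @ x # zs" "kb @ act_first R x x' zs u ls"] * vb len
        by (simp add: slide_right_def)
    qed
    finally show ?thesis .
  qed
qed (use obs in auto)

section \<open>Identity families and evaluation of composites\<close>

text \<open>Defined directly and not as the loosening of \<open>tight_id\<close>, because loosening
  is itself expressed through it. That the two agree is \<open>post_loose_tight_id\<close>.\<close>

definition loose_id :: "('c, 'ca, 'd, 'da) cfunctor \<Rightarrow> 'c list \<Rightarrow> 'm list \<Rightarrow> 'm" where
  "loose_id S = fam [S] (\<lambda>xs ks. hd ks)"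

definition tight_id :: "('c, 'ca, 'd, 'da) cfunctor \<Rightarrow> 'c list \<Rightarrow> 'm list \<Rightarrow> 'da" where
  "tight_id S = fam [] (\<lambda>xs ks. idt D (fobj S (hd xs)))"

lemma loose_id_apply: "\<lbrakk>x \<in> obj C; y \<in> obj C; k \<in> het \<O> x (fobj S y)\<rbrakk> \<Longrightarrow> loose_id S [x, y] [k] = k"
  unfolding loose_id_def by (subst fam_apply) (simp_all add: chain_Cons)

lemma tight_id_apply: "x \<in> obj C \<Longrightarrow> tight_id S [x] [] = idt D (fobj S x)"
  unfolding tight_id_def by (subst fam_apply) simp_all

lemma loose_id_families:
  assumes "S \<in> functors C D"
  shows "loose_id S \<in> families C \<O> \<O> [S] S"
  unfolding loose_id_def
proof (rule fam_familiesI)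
  show "hd ks \<in> het \<O> (hd xs) (fobj S (last xs))" if "chain [S] xs ks" for xs ks
    using that by (auto elim!: chain_ConsE)
  fix L R ys x x' zs u ks ls
  assume LR: "[S] = L @ R" and u: "u \<in> arr C x x'" and x: "x \<in> obj C" "x' \<in> obj C"
    and L: "chain L (ys @ [x]) ks" and R: "chain R (x' # zs) ls"
  from LR consider "L = []" "R = [S]" | "L = [S]" "R = []" by (auto simp: Cons_eq_append_conv)
  then show "slide_left \<O> S (\<lambda>xs. hd) L ys x x' zs u ks ls = slide_right \<O> S (\<lambda>xs. hd) R ys x x' zs u ks ls"
  proof cases
    case 1
    with L R show ?thesis
      by (auto simp: slide_left_def slide_right_def act_first_def elim!: chain_ConsE)
  next
    case 2
    with L R show ?thesis
      by (auto simp: slide_left_def slide_right_def act_last_def elim!: chain_ConsE)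
  qed
qed (use assms in auto)

lemma tight_id_families:
  assumes "S \<in> functors C D"
  shows "tight_id S \<in> families C \<O> (companion D S) [] S"
  unfolding tight_id_def
  by (rule fam_familiesI)
    (use functorsD[OF assms] in
      \<open>auto simp: slide_left_def slide_right_def D.idt_closed D.idt_cmp D.cmp_idt\<close>)

abbreviation subst where
  "subst As Bs Cs g f \<equiv> fam (As @ Bs @ Cs) (subst_at (length As) (length Bs) g f)"

abbreviation post where
  "post P As X Bs Y f g \<equiv> fam (As @ Bs) (post_at P X Y (length As) f g)"

lemma subst_apply:
  assumes "length ys = length As" "chain As (ys @ [hd ws]) ks" "chain Bs ws ls" "chain Cs (last ws # zs) ms"
  shows "subst As Bs Cs g f (ys @ ws @ zs) (ks @ ls @ ms) = g (ys @ hd ws # last ws # zs) (ks @ f ws ls # ms)"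
  using chain_append3[OF assms] assms chain_length[OF assms(2)] chain_length[OF assms(3)]
  by (simp add: fam_apply subst_at_append)

lemma post_apply:
  assumes "chain As (ys @ [x]) ks" "chain Bs (x # zs) ls"
  shows "post P As X Bs Y f g (ys @ x # zs) (ks @ ls)
    = ract P (hd (ys @ [x])) (fobj X x) (fobj Y (last (x # zs))) (f (ys @ [x]) ks) (g (x # zs) ls)"
  unfolding fam_apply[OF chain_append_hdI[OF assms]]
  by (rule post_at_append) (use chain_length[OF assms(1)] in auto)

text \<open>The two sides of a law are restricted to appends that are bracketed differently, hence
  the separate lists \<open>Ts\<close> and \<open>Ts'\<close>.\<close>

lemma fam_eqI:
  assumes "Ts' = Ts" "\<And>xs ks. chain Ts xs ks \<Longrightarrow> fam Ts h xs ks = fam Ts' h' xs ks"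
  shows "fam Ts h = fam Ts' h'"
  using assms by (auto intro!: fam_cong simp: fam_apply)

lemma chain_append_hd:
  assumes "chain As (ys @ [hd zs]) ks" "chain Bs zs ls"
  shows "chain (As @ Bs) (ys @ zs) (ks @ ls)"
  using chain_append_hdI[of As ys "hd zs" ks Bs "tl zs" ls] assms chain_hd_last(1)[OF assms(2)] by simp

lemma chain_append_last:
  assumes "chain As ys ks" "chain Bs (last ys # zs) ls"
  shows "chain (As @ Bs) (ys @ zs) (ks @ ls)"
  using chain_append_hdI[of As "butlast ys" "last ys" ks Bs zs ls] assms chain_hd_last(1)[OF assms(1)]
  by (metis append.assoc append_Cons append_Nil append_butlast_last_id)

subsection \<open>Associativity, interchange and units\<close>

text \<open>Both sides evaluate to \<open>h\<close> applied after the inner block and then the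
  middle block have been contracted. As \<open>h\<close> may have values of any kind, this covers
  \<open>assoc_AA\<close> and \<open>assoc_CA\<close>.\<close>

lemma subst_assoc:
  assumes f: "f \<in> families C \<O> \<O> As X" and g: "g \<in> families C \<O> \<O> (Bs @ X # Cs) Y"
  shows "subst Ds (Bs @ As @ Cs) Es h (subst Bs As Cs g f)
    = subst (Ds @ Bs) As (Cs @ Es) (subst Ds (Bs @ X # Cs) Es h g) f"
proof (rule fam_eqI)
  fix xs ks
  assume "chain (Ds @ (Bs @ As @ Cs) @ Es) xs ks"
  then obtain ys ws zs k1 k2 k3 where 1: "xs = ys @ ws @ zs" "ks = k1 @ k2 @ k3" "length ys = length Ds"
    "chain Ds (ys @ [hd ws]) k1" "chain (Bs @ As @ Cs) ws k2" "chain Es (last ws # zs) k3"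
    by (rule chain_split3E)
  from 1(5) obtain b a c kb ka kc where 2: "ws = b @ a @ c" "k2 = kb @ ka @ kc" "length b = length Bs"
    "chain Bs (b @ [hd a]) kb" "chain As a ka" "chain Cs (last a # c) kc"
    by (rule chain_split3E)
  have a: "a \<noteq> []" using chain_hd_last(1)[OF 2(5)] .
  let ?w = "b @ hd a # last a # c"
  \<comment> \<open>Contracting the inner block keeps the end objects of the middle one, so the
    outer typing is unaffected.\<close>
  have w: "hd ws = hd ?w" "last ws = last ?w" using 2 a by (simp_all add: hd_append)
  have fa: "f a ka \<in> het \<O> (hd a) (fobj X (last a))" by (rule families_het[OF f 2(5)])
  have chw: "chain (Bs @ X # Cs) ?w (kb @ f a ka # kc)"
    using 2 fa chain_hd_last[OF 2(5)] by (intro chain_append_hdI) (auto simp: chain_Cons)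
  have "subst Ds (Bs @ As @ Cs) Es h (subst Bs As Cs g f) xs ks = h (ys @ hd ws # last ws # zs) (k1 @ g ?w (kb @ f a ka # kc) # k3)"
    unfolding 1(1,2) subst_apply[OF 1(3,4,5,6)] unfolding 2(1,2) subst_apply[OF 2(3,4,5,6)] ..
  moreover have "chain (Ds @ Bs) ((ys @ b) @ [hd a]) (k1 @ kb)"
  proof -
    have "hd ws = hd (b @ [hd a])" using 2(1) a by (cases b) auto
    then have "chain (Ds @ Bs) (ys @ (b @ [hd a])) (k1 @ kb)"
      using 1(4) by (intro chain_append_hd[OF _ 2(4)]) simp
    then show ?thesis by simp
  qed
  moreover have "chain (Cs @ Es) (last a # c @ zs) (kc @ k3)"
    using chain_append_last[of Cs "last a # c" kc Es zs k3] 1(6) 2(6) w by simp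
  moreover have "subst Ds (Bs @ X # Cs) Es h g (ys @ ?w @ zs) (k1 @ (kb @ f a ka # kc) @ k3)
      = h (ys @ hd ?w # last ?w # zs) (k1 @ g ?w (kb @ f a ka # kc) # k3)"
    using 1 w by (intro subst_apply[OF _ _ chw]) simp_all
  ultimately show "subst Ds (Bs @ As @ Cs) Es h (subst Bs As Cs g f) xs ks
      = subst (Ds @ Bs) As (Cs @ Es) (subst Ds (Bs @ X # Cs) Es h g) f xs ks"
    using subst_apply[of "ys @ b" "Ds @ Bs" a "k1 @ kb" As ka "Cs @ Es" "c @ zs" "kc @ k3"
        "subst Ds (Bs @ X # Cs) Es h g" f] 1 2 w
    by simp
qed simp

text \<open>Both sides evaluate to \<open>h\<close> with the two blocks contracted, for
  \<open>h\<close> loose or tight. The two blocks overlap in an object exactly when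
  \<open>Bs\<close> is empty, which is why that case is treated apart.\<close>

lemma subst_interchange:
  assumes f: "f \<in> families C \<O> \<O> Ds X" and g: "g \<in> families C \<O> \<O> Es Y"
  shows "subst (As @ Ds @ Bs) Es Cs (subst As Ds (Bs @ Y # Cs) h f) g
    = subst As Ds (Bs @ Es @ Cs) (subst (As @ X # Bs) Es Cs h g) f" (is "?l = ?r")
proof (rule fam_eqI)
  fix xs ks
  assume "chain ((As @ Ds @ Bs) @ Es @ Cs) xs ks"
  then have "chain (As @ Ds @ (Bs @ Es @ Cs)) xs ks" by simp
  then obtain a d r ka kd kr where 1: "xs = a @ d @ r" "ks = ka @ kd @ kr" "length a = length As"
    "length d = Suc (length Ds)" "length kd = length Ds"
    "chain As (a @ [hd d]) ka" "chain Ds d kd" "chain (Bs @ Es @ Cs) (last d # r) kr"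
    by (rule chain_split3E)
  from 1(8) obtain b e c kb ke kc where 2: "last d # r = b @ e @ c" "kr = kb @ ke @ kc"
    "length b = length Bs" "length kb = length Bs" "length e = Suc (length Es)" "length ke = length Es"
    "chain Bs (b @ [hd e]) kb" "chain Es e ke" "chain Cs (last e # c) kc"
    by (rule chain_split3E)
  have fd: "f d kd \<in> het \<O> (hd d) (fobj X (last d))" by (rule families_het[OF f 1(7)])
  have ge: "g e ke \<in> het \<O> (hd e) (fobj Y (last e))" by (rule families_het[OF g 2(8)])
  have ob: "hd d \<in> obj C" "last d \<in> obj C" "hd e \<in> obj C" "last e \<in> obj C"
    using chain_hd_last[OF 1(7)] chain_hd_last[OF 2(8)] by auto
  have d: "d \<noteq> []" and e: "e \<noteq> []" using 1 2 by auto
  have chY: "chain (Y # Cs) (hd e # last e # c) (g e ke # kc)"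
    using 2 ge ob by (simp add: chain_Cons)
  have chX: "chain (As @ [X]) ((a @ [hd d]) @ [last d]) (ka @ [f d kd])"
    using 1 fd ob by (simp add: chain_rev)
  have chAD: "chain (As @ Ds) (a @ d) (ka @ kd)" using chain_append_hd[OF 1(6,7)] .
  have chBY: "chain (Bs @ Y # Cs) (b @ hd e # last e # c) (kb @ g e ke # kc)"
    by (rule chain_append_hdI[OF 2(7) chY])
  have chEC: "chain (Es @ Cs) (e @ c) (ke @ kc)" using chain_append_last[OF 2(8,9)] .
  show "?l xs ks = ?r xs ks"
  proof (cases b)
    case Nil
    \<comment> \<open>The two blocks are adjacent and share the object \<open>last d = hd e\<close>.\<close>
    with 2 have [simp]: "Bs = []" "kb = []" by auto
    from Nil 2(1) e have e': "hd e = last d" "e = last d # tl e" "r = tl e @ c" by (cases e; auto)+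
    obtain d' where d': "d = d' @ [last d]" using d by (metis append_butlast_last_id)
    have ld': "length d' = length Ds" using 1(4) by (subst (asm) d') simp
    have "?l xs ks = subst As Ds (Y # Cs) h f ((a @ d') @ hd e # last e # c) ((ka @ kd) @ g e ke # kc)"
    proof -
      have "xs = (a @ d') @ e @ c" unfolding 1(1) e'(3) by (subst d') (use e'(2) in simp)
      then show ?thesis
        using subst_apply[of "a @ d'" "As @ Ds" e "ka @ kd" Es ke Cs c kc "subst As Ds (Y # Cs) h f" g]
          1 2 chAD d' ld' e'(1) by simp
    qed
    also have "\<dots> = subst As Ds (Y # Cs) h f (a @ d @ last e # c) (ka @ kd @ g e ke # kc)"
    proof -
      have *: "(a @ d') @ hd e # last e # c = a @ d @ last e # c"
        using arg_cong[OF d', of "\<lambda>z. a @ z @ last e # c"] e'(1) by simp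
      show ?thesis unfolding * by simp
    qed
    also have "\<dots> = h (a @ hd d # last d # last e # c) (ka @ f d kd # g e ke # kc)"
      using 1 chY e' by (intro subst_apply) simp_all
    also have "\<dots> = subst (As @ [X]) Es Cs h g ((a @ [hd d]) @ e @ c) ((ka @ [f d kd]) @ ke @ kc)"
      using subst_apply[of "a @ [hd d]" "As @ [X]" e "ka @ [f d kd]" Es ke Cs c kc h g]
        1 2 chX e' by simp
    also have "\<dots> = ?r xs ks"
    proof -
      have "e @ c = last d # tl e @ c" by (metis e'(2) append_Cons)
      then have "a @ hd d # last d # r = (a @ [hd d]) @ e @ c" unfolding e'(3) by simp
      then show ?thesis
        using subst_apply[of a As d ka Ds kd "Es @ Cs" r "ke @ kc" "subst (As @ [X]) Es Cs h g" f] 1 2 Nil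
        by simp
    qed
    finally show ?thesis .
  next
    case (Cons b0 b')
    \<comment> \<open>The segment for \<open>Bs\<close> starts at the last object of
      \<open>d\<close>, which is already listed in \<open>d\<close>; only \<open>b'\<close> is
      new.\<close>
    with 2(1) have b: "b = last d # b'" "r = b' @ e @ c" by auto
    have chADB: "chain (As @ Ds @ Bs) ((a @ d @ b') @ [hd e]) (ka @ kd @ kb)"
      using chain_append_last[of "As @ Ds" "a @ d" "ka @ kd" Bs "b' @ [hd e]" kb] chAD 2(7) b d by simp
    have chAXB: "chain (As @ X # Bs) ((a @ hd d # last d # b') @ [hd e]) (ka @ f d kd # kb)"
      using chain_append_hdI[of "As @ [X]" "a @ [hd d]" "last d" "ka @ [f d kd]" Bs "b' @ [hd e]" kb] chX 2(7) b by simp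
    have len: "length (a @ d @ b') = length (As @ Ds @ Bs)" "length (a @ hd d # last d # b') = length (As @ X # Bs)"
      using 1 2 b by auto
    have "?l xs ks = subst As Ds (Bs @ Y # Cs) h f ((a @ d @ b') @ hd e # last e # c) ((ka @ kd @ kb) @ g e ke # kc)"
      using subst_apply[OF len(1) chADB 2(8,9), of "subst As Ds (Bs @ Y # Cs) h f" g] 1 2 b by simp
    also have "\<dots> = h (a @ hd d # last d # b' @ hd e # last e # c) (ka @ f d kd # kb @ g e ke # kc)"
      using subst_apply[of a As d ka Ds kd "Bs @ Y # Cs" "b' @ hd e # last e # c" "kb @ g e ke # kc" h f] 1 chBY b
      by simp
    also have "\<dots> = subst (As @ X # Bs) Es Cs h g ((a @ hd d # last d # b') @ e @ c) ((ka @ f d kd # kb) @ ke @ kc)"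
      using subst_apply[OF len(2) chAXB 2(8,9), of h g] by simp
    also have "\<dots> = ?r xs ks"
      using subst_apply[of a As d ka Ds kd "Bs @ Es @ Cs" r kr "subst (As @ X # Bs) Es Cs h g" f] 1 2 b by simp
    finally show ?thesis .
  qed
qed simp

text \<open>After evaluation this is \<open>ract_ract\<close> in \<open>P\<close>. A companion for
  \<open>P\<close> gives \<open>assoc_BB\<close>; \<open>P = \<O>\<close> with
  \<open>loose_id\<close> in front gives the compatibility of loosening with
  \<open>compB\<close>.\<close>

lemma post_assoc:
  assumes P: "bimodule C D P"
    and obs: "X \<in> functors C D" "Y \<in> functors C D" "Z \<in> functors C D"
    and f: "f \<in> families C \<O> P As X" and g: "g \<in> families C \<O> (companion D X) Cs Y"
    and h: "h \<in> families C \<O> (companion D Y) Es Z"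
  shows "post P (As @ Cs) Y Es Z (post P As X Cs Y f g) h
    = post P As X (Cs @ Es) Z f (post (companion D X) Cs Y Es Z g h)"
proof (rule fam_eqI)
  interpret P: bimodule C D P by (rule P)
  fix xs ks
  assume "chain ((As @ Cs) @ Es) xs ks"
  then obtain ys v c ks' k3 where 1: "xs = ys @ v # c" "ks = ks' @ k3"
    "chain (As @ Cs) (ys @ [v]) ks'" "chain Es (v # c) k3"
    by (rule chain_splitE)
  from 1(3) obtain a w b k1 k2 where 2: "ys @ [v] = a @ w # b" "ks' = k1 @ k2"
    "chain As (a @ [w]) k1" "chain Cs (w # b) k2"
    by (rule chain_splitE)
  have v: "v = last (w # b)" using arg_cong[OF 2(1), of last] by simp
  have "xs = (ys @ [v]) @ c" using 1(1) by simp
  then have xs: "xs = a @ w # b @ c" unfolding 2(1) by simp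
  have chCE: "chain (Cs @ Es) (w # b @ c) (k2 @ k3)"
    using chain_append_last[of Cs "w # b" k2 Es c k3] 1 2 v by simp
  have hd: "hd (ys @ [v]) = hd (a @ [w])" by (simp add: 2(1) hd_append)
  note ob = chain_hd_last[OF 2(3)] chain_hd_last[OF 2(4)] chain_hd_last[OF 1(4)]
  have "post P (As @ Cs) Y Es Z (post P As X Cs Y f g) h xs ks
    = ract P (hd (a @ [w])) (fobj Y v) (fobj Z (last (v # c)))
        (ract P (hd (a @ [w])) (fobj X w) (fobj Y v) (f (a @ [w]) k1) (g (w # b) k2)) (h (v # c) k3)"
  proof -
    have "post P As X Cs Y f g (ys @ [v]) ks'
        = ract P (hd (a @ [w])) (fobj X w) (fobj Y v) (f (a @ [w]) k1) (g (w # b) k2)"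
      unfolding 2(1,2) post_apply[OF 2(3,4)] using v by simp
    then show ?thesis unfolding 1(1,2) post_apply[OF 1(3,4)] hd by simp
  qed
  also have "\<dots> = ract P (hd (a @ [w])) (fobj X w) (fobj Z (last (v # c))) (f (a @ [w]) k1)
      (cmp D (fobj X w) (fobj Y v) (fobj Z (last (v # c))) (g (w # b) k2) (h (v # c) k3))"
    using ob families_het[OF f 2(3)] families_het[OF g 2(4)] families_het[OF h 1(4)] obs v
    by (intro P.ract_ract[symmetric]) (auto intro: functorsD)
  also have "cmp D (fobj X w) (fobj Y v) (fobj Z (last (v # c))) (g (w # b) k2) (h (v # c) k3)
    = post (companion D X) Cs Y Es Z g h (w # b @ c) (k2 @ k3)"
  proof -
    \<comment> \<open>The path \<open>w # b\<close> is rewritten so that its last object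
      \<open>v\<close> is exposed, since \<open>post_apply\<close> cuts there; \<open>v\<close> is
      \<open>w\<close> itself when \<open>b\<close> is empty.\<close>
    define b' where "b' = butlast (w # b)"
    have b': "b' @ [v] = w # b" unfolding b'_def v by (rule append_butlast_last_id) simp
    have "(b' @ [v]) @ c = w # b @ c" unfolding b' by simp
    then have eq: "w # b @ c = b' @ v # c" by simp
    have "hd (b' @ [v]) = w" unfolding b' by simp
    then show ?thesis unfolding eq
      using post_apply[of Cs b' v k2 Es c k3 "companion D X" Y Z g h] 1(4) 2(4) b' by simp
  qed
  also have "ract P (hd (a @ [w])) (fobj X w) (fobj Z (last (v # c))) (f (a @ [w]) k1) \<dots>
    = post P As X (Cs @ Es) Z f (post (companion D X) Cs Y Es Z g h) xs ks"
  proof -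
    have "last (v # c) = last (w # b @ c)" using v by simp
    then show ?thesis
      using post_apply[OF 2(3) chCE, of P X Z f "post (companion D X) Cs Y Es Z g h"]
        xs 1(2) 2(2) by simp
  qed
  finally show "post P (As @ Cs) Y Es Z (post P As X Cs Y f g) h xs ks
    = post P As X (Cs @ Es) Z f (post (companion D X) Cs Y Es Z g h) xs ks" .
qed simp

text \<open>The factor \<open>h\<close> reads only the part of the path after the last object of the
  block for \<open>g\<close>, and contracting inside that block does not move this object. It yields
  \<open>assoc_BC\<close> and, with \<open>loose_id\<close> for \<open>g\<close>, the lemma
  \<open>subst_post_loose_id\<close>.\<close>

lemma post_subst_left:
  assumes f: "f \<in> families C \<O> \<O> As X"
  shows "post P (Bs @ As @ Cs) Y Es Z (subst Bs As Cs g f) h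
    = subst Bs As (Cs @ Es) (post P (Bs @ X # Cs) Y Es Z g h) f"
proof (rule fam_eqI)
  fix xs ks
  assume "chain ((Bs @ As @ Cs) @ Es) xs ks"
  then obtain ys v e ks' ke where 1: "xs = ys @ v # e" "ks = ks' @ ke"
    "chain (Bs @ As @ Cs) (ys @ [v]) ks'" "chain Es (v # e) ke"
    by (rule chain_splitE)
  from 1(3) obtain b a c kb ka kc where 2: "ys @ [v] = b @ a @ c" "ks' = kb @ ka @ kc" "length b = length Bs"
    "chain Bs (b @ [hd a]) kb" "chain As a ka" "chain Cs (last a # c) kc"
    by (rule chain_split3E)
  have a: "a \<noteq> []" using chain_hd_last(1)[OF 2(5)] .
  let ?w = "b @ hd a # last a # c"
  have fa: "f a ka \<in> het \<O> (hd a) (fobj X (last a))" by (rule families_het[OF f 2(5)])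
  have chw: "chain (Bs @ X # Cs) ?w (kb @ f a ka # kc)"
    using 2 fa chain_hd_last[OF 2(5)] by (intro chain_append_hdI) (auto simp: chain_Cons)
  have v: "v = last (last a # c)" using arg_cong[OF 2(1), of last] a by simp
  have chCE: "chain (Cs @ Es) (last a # c @ e) (kc @ ke)"
    using chain_append_last[of Cs "last a # c" kc Es e ke] 1 2 v by simp
  define w' where "w' = butlast ?w"
  have w': "?w = w' @ [v]"
  proof -
    have v': "v = last ?w" using v by simp
    show ?thesis unfolding w'_def v' by (rule append_butlast_last_id[symmetric]) simp
  qed
  have hd: "hd (ys @ [v]) = hd (w' @ [v])" unfolding 2(1) w'[symmetric] using a by (simp add: hd_append)
  have "xs = (ys @ [v]) @ e" using 1(1) by simp
  then have xs: "xs = b @ a @ c @ e" unfolding 2(1) by simp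
  have "b @ hd a # last a # c @ e = ?w @ e" by simp
  then have we: "b @ hd a # last a # c @ e = w' @ v # e" unfolding w' by simp
  have "post P (Bs @ As @ Cs) Y Es Z (subst Bs As Cs g f) h xs ks
    = ract P (hd (w' @ [v])) (fobj Y v) (fobj Z (last (v # e))) (g ?w (kb @ f a ka # kc)) (h (v # e) ke)"
    unfolding 1(1,2) post_apply[OF 1(3,4)] hd unfolding 2(1,2) subst_apply[OF 2(3,4,5,6)] ..
  also have "\<dots> = post P (Bs @ X # Cs) Y Es Z g h (b @ hd a # last a # c @ e) (kb @ f a ka # kc @ ke)"
    using post_apply[of "Bs @ X # Cs" w' v "kb @ f a ka # kc" Es e ke P Y Z g h] chw 1(4) unfolding w' we by simp
  also have "\<dots> = subst Bs As (Cs @ Es) (post P (Bs @ X # Cs) Y Es Z g h) f xs ks"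
    using subst_apply[OF 2(3,4,5) chCE, of "post P (Bs @ X # Cs) Y Es Z g h" f] xs 1(2) 2(2) by simp
  finally show "post P (Bs @ As @ Cs) Y Es Z (subst Bs As Cs g f) h xs ks
    = subst Bs As (Cs @ Es) (post P (Bs @ X # Cs) Y Es Z g h) f xs ks" .
qed simp

text \<open>The first factor reads only the path up to \<open>v\<close>, and contracting the block
  for \<open>Es\<close> preserves \<open>v\<close> as starting object of the second factor. It
  yields \<open>interchange_BC\<close> and, with \<open>loose_id\<close> for \<open>f\<close>, the
  compatibility of loosening with \<open>compC\<close>.\<close>

lemma post_subst_right:
  assumes g: "g \<in> families C \<O> \<O> Es Y"
  shows "subst (Ds @ Bs) Es Cs (post P Ds X (Bs @ Y # Cs) Z f h) g
    = post P Ds X (Bs @ Es @ Cs) Z f (subst Bs Es Cs h g)"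
proof (rule fam_eqI)
  fix xs ks
  assume "chain ((Ds @ Bs) @ Es @ Cs) xs ks"
  then have "chain (Ds @ (Bs @ Es @ Cs)) xs ks" by simp
  then obtain d v r kd kr where 1: "xs = d @ v # r" "ks = kd @ kr" "length d = length Ds"
    "chain Ds (d @ [v]) kd" "chain (Bs @ Es @ Cs) (v # r) kr"
    by (rule chain_splitE)
  from 1(5) obtain b e c kb ke kc where 2: "v # r = b @ e @ c" "kr = kb @ ke @ kc" "length b = length Bs"
    "chain Bs (b @ [hd e]) kb" "chain Es e ke" "chain Cs (last e # c) kc"
    by (rule chain_split3E)
  have e: "e \<noteq> []" using chain_hd_last(1)[OF 2(5)] .
  let ?w = "b @ hd e # last e # c"
  have ge: "g e ke \<in> het \<O> (hd e) (fobj Y (last e))" by (rule families_het[OF g 2(5)])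
  have chw: "chain (Bs @ Y # Cs) ?w (kb @ g e ke # kc)"
    using 2 ge chain_hd_last[OF 2(5)] by (intro chain_append_hdI) (auto simp: chain_Cons)
  have v: "v = hd (b @ [hd e])" using arg_cong[OF 2(1), of hd] e by (cases b) simp_all
  obtain w' where w': "?w = v # w'" unfolding v by (cases b) auto
  have last: "last (v # w') = last (v # r)" unfolding w'[symmetric] 2(1) using e by simp
  have chDB: "chain (Ds @ Bs) ((d @ b) @ [hd e]) (kd @ kb)"
    using chain_append_hd[of Ds d "b @ [hd e]" kd Bs kb] 1 2 v by simp
  have xs: "xs = (d @ b) @ e @ c" using 1(1) 2(1) by simp
  have "subst (Ds @ Bs) Es Cs (post P Ds X (Bs @ Y # Cs) Z f h) g xs ks
    = post P Ds X (Bs @ Y # Cs) Z f h (d @ ?w) (kd @ kb @ g e ke # kc)"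
    using subst_apply[of "d @ b" "Ds @ Bs" e "kd @ kb" Es ke Cs c kc "post P Ds X (Bs @ Y # Cs) Z f h" g]
      xs 1 2 chDB by simp
  also have "\<dots> = ract P (hd (d @ [v])) (fobj X v) (fobj Z (last (v # r))) (f (d @ [v]) kd) (h ?w (kb @ g e ke # kc))"
    using post_apply[OF 1(4), of "Bs @ Y # Cs" w' "kb @ g e ke # kc" P X Z f h] chw unfolding w' last by simp
  also have "h ?w (kb @ g e ke # kc) = subst Bs Es Cs h g (v # r) kr"
    unfolding 2(1,2) subst_apply[OF 2(3,4,5,6)] ..
  also have "ract P (hd (d @ [v])) (fobj X v) (fobj Z (last (v # r))) (f (d @ [v]) kd) \<dots>
    = post P Ds X (Bs @ Es @ Cs) Z f (subst Bs Es Cs h g) xs ks"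
    unfolding 1(1,2) post_apply[OF 1(4,5)] ..
  finally show "subst (Ds @ Bs) Es Cs (post P Ds X (Bs @ Y # Cs) Z f h) g xs ks
    = post P Ds X (Bs @ Es @ Cs) Z f (subst Bs Es Cs h g) xs ks" .
qed simp

lemma subst_loose_id:
  assumes "g \<in> families C \<O> P (As @ X # Cs) Y"
  shows "subst As [X] Cs g (loose_id X) = g"
proof -
  have "subst As [X] Cs g (loose_id X) = fam (As @ X # Cs) g"
  proof (rule fam_eqI)
    fix xs ks
    assume ch: "chain (As @ [X] @ Cs) xs ks"
    then obtain ys ws zs k1 k2 k3 where *: "xs = ys @ ws @ zs" "ks = k1 @ k2 @ k3" "length ys = length As"
      "chain As (ys @ [hd ws]) k1" "chain [X] ws k2" "chain Cs (last ws # zs) k3"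
      by (rule chain_split3E)
    from *(5) obtain x y k where [simp]: "ws = [x, y]" "k2 = [k]"
      and "x \<in> obj C" "y \<in> obj C" "k \<in> het \<O> x (fobj X y)"
      by (auto elim!: chain_ConsE)
    then show "subst As [X] Cs g (loose_id X) xs ks = fam (As @ X # Cs) g xs ks"
      using ch unfolding *(1,2) subst_apply[OF *(3-6)] by (simp add: fam_apply loose_id_apply)
  qed simp
  then show ?thesis using fam_families[OF assms] by simp
qed

lemma subst_into_loose_id:
  assumes "f \<in> families C \<O> \<O> As X"
  shows "subst [] As [] (loose_id X) f = f"
proof -
  have "subst [] As [] (loose_id X) f = fam As f"
  proof (rule fam_eqI)
    fix xs ks
    assume "chain ([] @ As @ []) xs ks"
    then have ch: "chain As xs ks" by simp
    then show "subst [] As [] (loose_id X) f xs ks = fam As f xs ks"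
      using subst_apply[of "[]" "[]" xs "[]" As ks "[]" "[]" "[]" "loose_id X" f]
        chain_hd_last[OF ch] families_het[OF assms ch]
      by (simp add: fam_apply loose_id_apply)
  qed simp
  then show ?thesis using fam_families[OF assms] by simp
qed

text \<open>Left means first in diagrammatic order, so this is the axiom
  \<open>compB_tid_right\<close>; likewise \<open>post_tight_id_right\<close> gives
  \<open>compB_tid_left\<close>.\<close>

lemma post_tight_id_left:
  assumes "X \<in> functors C D" "Y \<in> functors C D" "g \<in> families C \<O> (companion D X) Bs Y"
  shows "post (companion D X) [] X Bs Y (tight_id X) g = g"
proof -
  have "post (companion D X) [] X Bs Y (tight_id X) g = fam Bs g"
  proof (rule fam_eqI)
    fix xs ks
    assume "chain ([] @ Bs) xs ks"
    then have ch: "chain Bs xs ks" by simp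
    obtain x zs where xs: "xs = x # zs" using chain_hd_last(1)[OF ch] by (cases xs) auto
    show "post (companion D X) [] X Bs Y (tight_id X) g xs ks = fam Bs g xs ks"
      using post_apply[of "[]" "[]" x "[]" Bs zs ks "companion D X" X Y "tight_id X" g]
        ch chain_hd_last[OF ch] families_het[OF assms(3) ch] assms xs
      by (simp add: fam_apply tight_id_apply D.idt_cmp functorsD)
  qed simp
  then show ?thesis using fam_families[OF assms(3)] by simp
qed

lemma post_tight_id_right:
  assumes "bimodule C D P" "X \<in> functors C D" "f \<in> families C \<O> P As X"
  shows "post P As X [] X f (tight_id X) = f"
proof -
  interpret P: bimodule C D P by fact
  have "post P As X [] X f (tight_id X) = fam As f"
  proof (rule fam_eqI)
    fix xs ks
    assume "chain (As @ []) xs ks"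
    then have ch: "chain As xs ks" by simp
    define ys x where "ys = butlast xs" and "x = last xs"
    have xs: "xs = ys @ [x]" unfolding ys_def x_def using chain_hd_last(1)[OF ch] by simp
    show "post P As X [] X f (tight_id X) xs ks = fam As f xs ks"
      using post_apply[of As ys x ks "[]" "[]" "[]" P X X f "tight_id X"]
        ch chain_hd_last[OF ch] families_het[OF assms(3) ch] assms xs
      by (simp add: fam_apply tight_id_apply P.ract_idt functorsD)
  qed simp
  then show ?thesis using fam_families[OF assms(3)] by simp
qed

text \<open>Substitution passes to the first factor, where substituting into \<open>loose_id\<close>
  returns \<open>f\<close>. Thus feeding \<open>f\<close> into the first input of a loosened family
  is the same as composing with the tight one.\<close>

lemma subst_post_loose_id:
  assumes "f \<in> families C \<O> \<O> As X"
  shows "subst [] As Bs (post P [X] X Bs Y (loose_id X) g) f = post P As X Bs Y f g"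
  using post_subst_left[OF assms, of "[]" "[]" Bs P X Y "loose_id X" g] subst_into_loose_id[OF assms]
  by simp

subsection \<open>The left-skew multicategory\<close>

abbreviation multicat where
  "multicat \<equiv> bimodule_multicat C D \<O>"

text \<open>Tight domains are matched as a cons because their first functor selects the companion
  and contributes no argument.\<close>

lemma multicat_simps [simp]:
  "mobj multicat = functors C D"
  "loose multicat Ts H = families C \<O> \<O> Ts H"
  "tight multicat Ts H = families C \<O> (companion D (hd Ts)) (tl Ts) H"
  "tid multicat S = tight_id S"
  "loosen multicat (S # Ts) H t = post \<O> [S] S Ts H (loose_id S) t"
  "compA multicat as x cs bs y g f = subst as bs cs g f"
  "compB multicat x bs (S # as) y q p = post (companion D S) as x bs y p q"
  "compC multicat (S # as) x cs bs y q f = subst as bs cs q f"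
proof -
  show "tid multicat S = tight_id S"
    unfolding tight_id_def bimodule_multicat_def fam_def
    by (auto simp: objs_def length_Suc_conv fun_eq_iff)
  show "loosen multicat (S # Ts) H t = post \<O> [S] S Ts H (loose_id S) t"
  proof -
    have "loosen multicat (S # Ts) H t = fam (S # Ts) (\<lambda>xs ks. ract \<O> (xs ! 0) (fobj S (xs ! 1))
        (fobj H (xs ! length (S # Ts))) (hd ks) (t (tl xs) (tl ks)))"
      by (simp add: bimodule_multicat_def fam_def)
    also have "\<dots> = post \<O> [S] S Ts H (loose_id S) t"
      unfolding append.simps
    proof (rule fam_cong)
      fix xs ks
      assume ch: "chain (S # Ts) xs ks"
      then show "ract \<O> (xs ! 0) (fobj S (xs ! 1)) (fobj H (xs ! length (S # Ts))) (hd ks) (t (tl xs) (tl ks))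
          = post_at \<O> S H (length [S]) (loose_id S) t xs ks"
        unfolding chain_nth[OF ch] by (elim chain_ConsE) (simp add: post_at_def loose_id_apply)
    qed
    finally show ?thesis .
  qed
  show "compB multicat x bs (S # as) y q p = post (companion D S) as x bs y p q"
  proof -
    have "compB multicat x bs (S # as) y q p = fam (as @ bs) (\<lambda>xs ks.
        cmp D (fobj S (xs ! 0)) (fobj x (xs ! length as)) (fobj y (xs ! length (as @ bs)))
          (p (take (Suc (length as)) xs) (take (length as) ks)) (q (drop (length as) xs) (drop (length as) ks)))"
      by (simp add: bimodule_multicat_def fam_def Let_def)
    also have "\<dots> = post (companion D S) as x bs y p q"
      by (rule fam_cong) (simp only: chain_nth post_at_def ract_companion)
    finally show ?thesis .
  qed
qed (simp_all add: bimodule_multicat_def fam_def)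

lemma self: "bimodule C D \<O>" ..

lemma post_loose_tight_id:
  "X \<in> functors C D \<Longrightarrow> post \<O> [X] X [] X (loose_id X) (tight_id X) = loose_id X"
  by (intro post_tight_id_right self loose_id_families)

text \<open>The goals follow the order of the locale assumptions: closure in 1 to 5, loosening in 6
  and 7, units in 8 to 12, associativity in 13 to 16, interchange in 17 to 19.\<close>

lemma left_skew_multicategory_multicat: "left_skew_multicategory multicat"
proof (unfold_locales, goal_cases)
  case (1 as x f)
  then obtain S As where as: "as = S # As" by (cases as) auto
  show ?case using 1 post_families[OF self, of "[S]" As S x "loose_id S" f] by (simp add: as loose_id_families)
next
  case (2 x)
  then show ?case by (simp add: tight_id_families)
next
  case (3 as bs cs x y f g)
  then show ?case using subst_families[OF self] by simp
next
  case (4 as bs x y f g)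
  then obtain S As where as: "as = S # As" by (cases as) auto
  show ?case using 4 post_families[OF companion_bimodule] by (simp add: as)
next
  case (5 as bs cs x y f g)
  then obtain S As where as: "as = S # As" by (cases as) auto
  show ?case using 5 subst_families[OF companion_bimodule] by (simp add: as)
next
  case (6 as bs x y f g)
  then obtain S As where as: "as = S # As" by (cases as) auto
  have f: "f \<in> families C \<O> (companion D S) As x" and ob: "S \<in> functors C D" "set As \<subseteq> functors C D"
    using 6 as by auto
  let ?F = "post \<O> [S] S As x (loose_id S) f"
  have "?F \<in> families C \<O> \<O> ([S] @ As) x"
    by (rule post_families[OF self]) (use 6 f ob loose_id_families in auto)
  \<comment> \<open>The composite of two loosened families is read as the loosened \<open>?F\<close>
    followed by the tight \<open>g\<close>; reassociating then gives the loosening of the tight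
    composite.\<close>
  then have "subst [] (S # As) bs (post \<O> [x] x bs y (loose_id x) g) ?F = post \<O> (S # As) x bs y ?F g"
    by (intro subst_post_loose_id) simp
  also have "\<dots> = post \<O> [S] S (As @ bs) y (loose_id S) (post (companion D S) As x bs y f g)"
    using post_assoc[OF self, of S x y "loose_id S" "[S]" f As g bs] 6 f ob loose_id_families by simp
  finally show ?case by (simp add: as)
next
  case (7 as bs cs x y f g)
  then obtain S As where as: "as = S # As" by (cases as) auto
  then show ?case using post_subst_right[of f bs x "[S]" As cs \<O> S y "loose_id S" g] 7 by simp
next
  case (8 as cs x y g)
  then show ?case
    by (simp add: post_loose_tight_id[simplified] subst_loose_id[simplified])
next
  case (9 bs x y g)
  then show ?case by (simp add: post_tight_id_left[simplified])
next
  case (10 as cs x y g)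
  then obtain S As where as: "as = S # As" by (cases as) auto
  show ?case using 10 as
    by (simp add: post_loose_tight_id[simplified] subst_loose_id[simplified])
next
  case (11 as x f)
  then show ?case
    by (simp add: post_loose_tight_id[simplified] subst_into_loose_id[simplified])
next
  case (12 as x f)
  then obtain S As where as: "as = S # As" by (cases as) auto
  show ?case using 12 as post_tight_id_right[OF companion_bimodule, of S x f As] by simp
next
  case (13 as bs cs ds es x y z f g h)
  then show ?case using subst_assoc[of f as x g bs cs y ds es h] by simp
next
  case (14 as bs cs ds es x y z f g h)
  then obtain S Ds where ds: "ds = S # Ds" by (cases ds) auto
  show ?case using 14 ds subst_assoc[of f as x g bs cs y Ds es h] by simp
next
  case (15 as cs es x y z f g h)
  then obtain S As where as: "as = S # As" by (cases as) auto
  show ?case using 15 as post_assoc[OF companion_bimodule, of S x y z f As g cs h es] by simp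
next
  case (16 as bs cs es x y z f g h)
  then obtain S Bs where bs: "bs = S # Bs" by (cases bs) auto
  show ?case using 16 bs post_subst_left[of f as x Bs cs es "companion D S" y z g h] by simp
next
  case (17 as bs cs ds es x y z f g h)
  then show ?case using subst_interchange[of f ds x g es y as bs cs h] by simp
next
  case (18 as bs cs ds es x y z f g h)
  then obtain S As where as: "as = S # As" by (cases as) auto
  show ?case using 18 as subst_interchange[of f ds x g es y As bs cs h] by simp
next
  case (19 bs cs ds es x y z f g h)
  then obtain S Ds where ds: "ds = S # Ds" by (cases ds) auto
  show ?case using 19 ds post_subst_right[of g es y Ds bs cs "companion D S" x z f h] by simp
qed

subsection \<open>Monoids and relative monads\<close>

lemma chain_single: "chain [T] xs ks
    \<longleftrightarrow> (\<exists>x y k. xs = [x, y] \<and> ks = [k] \<and> x \<in> obj C \<and> y \<in> obj C \<and> k \<in> het \<O> x (fobj T y))"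
  by (auto simp: chain_Cons elim!: chain_ConsE)

lemma chain_pair: "chain [S, T] xs ks
    \<longleftrightarrow> (\<exists>x y z k l. xs = [x, y, z] \<and> ks = [k, l] \<and> x \<in> obj C \<and> y \<in> obj C \<and> z \<in> obj C \<and>
          k \<in> het \<O> x (fobj S y) \<and> l \<in> het \<O> y (fobj T z))"
  by (auto simp: chain_Cons elim!: chain_ConsE)

lemma fam_eq_iff: "fam Ts h = fam Ts h' \<longleftrightarrow> (\<forall>xs ks. chain Ts xs ks \<longrightarrow> h xs ks = h' xs ks)"
  using fam_cong fam_apply by metis

lemma families_eqI:
  assumes "f \<in> families C \<O> P Ts H" "g \<in> families C \<O> P' Ts H'"
    "\<And>xs ks. chain Ts xs ks \<Longrightarrow> f xs ks = g xs ks"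
  shows "f = g"
  using fam_families[OF assms(1)] fam_families[OF assms(2)] fam_cong[of Ts f g] assms(3) by metis

text \<open>Applied to a monoid multiplication, whose values lie in \<open>companion D T\<close>,
  the left action on the right-hand side is composition with \<open>farr T x x' u\<close>.\<close>

lemma families_single_natural_first:
  assumes "m \<in> families C \<O> P [T] H" "x \<in> obj C" "x' \<in> obj C" "z \<in> obj C" "u \<in> arr C x x'"
    "k \<in> het \<O> x' (fobj T z)"
  shows "m [x, z] [lact \<O> x x' (fobj T z) u k] = lact P x x' (fobj H z) u (m [x', z] [k])"
  using families_slide[of m P "[]" "[T]" H u x x' "[]" "[]" "[z]" "[k]"] assms
  by (simp add: slide_left_def slide_right_def chain_Cons)

lemma fam_Nil_familiesI:
  assumes "\<And>x. x \<in> obj C \<Longrightarrow> h x \<in> het P x (fobj H x)"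
    and "\<And>x x' u. \<lbrakk>x \<in> obj C; x' \<in> obj C; u \<in> arr C x x'\<rbrakk> \<Longrightarrow>
      lact P x x' (fobj H x') u (h x') = ract P x (fobj H x) (fobj H x') (h x) (farr H x x' u)"
  shows "fam [] (\<lambda>xs ks. h (hd xs)) \<in> families C \<O> P [] H"
  by (rule fam_familiesI) (use assms in \<open>auto simp: slide_left_def slide_right_def\<close>)

lemma fam_single_familiesI:
  assumes "T \<in> functors C D"
    and "\<And>x y k. \<lbrakk>x \<in> obj C; y \<in> obj C; k \<in> het \<O> x (fobj T y)\<rbrakk> \<Longrightarrow> h x y k \<in> het P x (fobj H y)"
    and "\<And>x x' z u k. \<lbrakk>x \<in> obj C; x' \<in> obj C; z \<in> obj C; u \<in> arr C x x'; k \<in> het \<O> x' (fobj T z)\<rbrakk> \<Longrightarrow>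
      lact P x x' (fobj H z) u (h x' z k) = h x z (lact \<O> x x' (fobj T z) u k)"
    and "\<And>w x x' u k. \<lbrakk>w \<in> obj C; x \<in> obj C; x' \<in> obj C; u \<in> arr C x x'; k \<in> het \<O> w (fobj T x)\<rbrakk> \<Longrightarrow>
      h w x' (ract \<O> w (fobj T x) (fobj T x') k (farr T x x' u))
        = ract P w (fobj H x) (fobj H x') (h w x k) (farr H x x' u)"
  shows "fam [T] (\<lambda>xs ks. h (hd xs) (last xs) (hd ks)) \<in> families C \<O> P [T] H"
proof (rule fam_familiesI)
  fix As Bs ys x x' zs u ks ls
  assume split: "[T] = As @ Bs" and u: "u \<in> arr C x x'" and x: "x \<in> obj C" "x' \<in> obj C"
    and A: "chain As (ys @ [x]) ks" and B: "chain Bs (x' # zs) ls"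
  let ?f = "\<lambda>xs ks. h (hd xs) (last xs) (hd ks)"
  from split consider "As = []" "Bs = [T]" | "As = [T]" "Bs = []" by (auto simp: Cons_eq_append_conv)
  then show "slide_left P H ?f As ys x x' zs u ks ls = slide_right P H ?f Bs ys x x' zs u ks ls"
  proof cases
    case 1
    with A B u x show ?thesis
      by (auto simp: slide_left_def slide_right_def act_first_def chain_single assms(3))
  next
    case 2
    with A B u x show ?thesis
      by (auto simp: slide_left_def slide_right_def act_last_def chain_single assms(4)
          Cons_eq_append_conv append_eq_Cons_conv)
  qed
qed (use assms(1,2) in \<open>auto simp: chain_single\<close>)

text \<open>Each monoid law equates two restricted families, so it can be tested on chains with one,
  no and two arguments respectively. The results are the laws \<open>\<eta>_star\<close>,
  \<open>star_\<eta>\<close> and \<open>star_star\<close> for the values of \<open>m\<close> and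
  \<open>e\<close>.\<close>

lemma skew_monoids_iff:
  assumes T: "T \<in> functors C D" and m: "m \<in> families C \<O> (companion D T) [T] T"
    and e: "e \<in> families C \<O> \<O> [] T"
  shows "(T, m, e) \<in> skew_monoids multicat \<longleftrightarrow>
    (\<forall>x\<in>obj C. \<forall>y\<in>obj C. \<forall>k\<in>het \<O> x (fobj T y).
       ract \<O> x (fobj T x) (fobj T y) (e [x] []) (m [x, y] [k]) = k) \<and>
    (\<forall>x\<in>obj C. m [x, x] [e [x] []] = idt D (fobj T x)) \<and>
    (\<forall>x\<in>obj C. \<forall>y\<in>obj C. \<forall>z\<in>obj C. \<forall>k\<in>het \<O> x (fobj T y). \<forall>l\<in>het \<O> y (fobj T z).
       cmp D (fobj T x) (fobj T y) (fobj T z) (m [x, y] [k]) (m [y, z] [l])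
         = m [x, z] [ract \<O> x (fobj T y) (fobj T z) k (m [y, z] [l])])"
proof -
  let ?l = "post \<O> [T] T [T] T (loose_id T) m"
  have eh: "e [x] [] \<in> het \<O> x (fobj T x)" if "x \<in> obj C" for x
    using families_het[OF e, of "[x]" "[]"] that by simp
  have l: "?l [x, y, z] [k, l] = ract \<O> x (fobj T y) (fobj T z) k (m [y, z] [l])"
    if "x \<in> obj C" "y \<in> obj C" "z \<in> obj C" "k \<in> het \<O> x (fobj T y)" "l \<in> het \<O> y (fobj T z)" for x y z k l
    using that by (simp add: fam_apply chain_pair post_at_def loose_id_apply)
  have "subst [] [] [T] ?l e = loose_id T \<longleftrightarrow>
    (\<forall>x\<in>obj C. \<forall>y\<in>obj C. \<forall>k\<in>het \<O> x (fobj T y).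
       ract \<O> x (fobj T x) (fobj T y) (e [x] []) (m [x, y] [k]) = k)"
  proof -
    \<comment> \<open>As \<open>e\<close> is nullary, the loosened multiplication is evaluated at
      the objects \<open>[x, x, y]\<close>.\<close>
    have "subst_at 0 0 ?l e [x, y] [k] = ract \<O> x (fobj T x) (fobj T y) (e [x] []) (m [x, y] [k])"
      if "x \<in> obj C" "y \<in> obj C" "k \<in> het \<O> x (fobj T y)" for x y k
      using l[OF that(1) that(1,2) eh that(3)] that by (simp add: subst_at_def)
    then show ?thesis by (auto simp: loose_id_def fam_eq_iff chain_single)
  qed
  moreover have "subst [] [] [] m e = tight_id T \<longleftrightarrow>
      (\<forall>x\<in>obj C. m [x, x] [e [x] []] = idt D (fobj T x))"
    by (auto simp: tight_id_def fam_eq_iff subst_at_def)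
  moreover have "post (companion D T) [T] T [T] T m m = subst [] [T, T] [] m ?l \<longleftrightarrow>
    (\<forall>x\<in>obj C. \<forall>y\<in>obj C. \<forall>z\<in>obj C. \<forall>k\<in>het \<O> x (fobj T y). \<forall>l\<in>het \<O> y (fobj T z).
       cmp D (fobj T x) (fobj T y) (fobj T z) (m [x, y] [k]) (m [y, z] [l])
         = m [x, z] [ract \<O> x (fobj T y) (fobj T z) k (m [y, z] [l])])"
  proof -
    have "subst_at 0 2 m ?l [x, y, z] [k, l] = m [x, z] [ract \<O> x (fobj T y) (fobj T z) k (m [y, z] [l])]"
      if "x \<in> obj C" "y \<in> obj C" "z \<in> obj C" "k \<in> het \<O> x (fobj T y)" "l \<in> het \<O> y (fobj T z)" for x y z k l
      using l[OF that] by (simp add: subst_at_def numeral_2_eq_2)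
    moreover have "post_at (companion D T) T T 1 m m [x, y, z] [k, l]
        = cmp D (fobj T x) (fobj T y) (fobj T z) (m [x, y] [k]) (m [y, z] [l])" for x y z k l
      by (simp add: post_at_def)
    moreover have "post (companion D T) [T] T [T] T m m = subst [] [T, T] [] m ?l \<longleftrightarrow>
        (\<forall>xs ks. chain [T, T] xs ks \<longrightarrow>
          post_at (companion D T) T T 1 m m xs ks = subst_at 0 2 m ?l xs ks)"
      by (simp add: fam_eq_iff numeral_2_eq_2)
    moreover have "\<dots> \<longleftrightarrow> (\<forall>x\<in>obj C. \<forall>y\<in>obj C. \<forall>z\<in>obj C.
        \<forall>k\<in>het \<O> x (fobj T y). \<forall>l\<in>het \<O> y (fobj T z).
          post_at (companion D T) T T 1 m m [x, y, z] [k, l] = subst_at 0 2 m ?l [x, y, z] [k, l])"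
      unfolding chain_pair by blast
    ultimately show ?thesis by simp
  qed
  ultimately show ?thesis using T m e
    by (simp add: skew_monoids_def post_loose_tight_id[simplified])
qed

lemma skew_monoidsD:
  assumes "(T, m, e) \<in> skew_monoids multicat"
  shows "T \<in> functors C D" "m \<in> families C \<O> (companion D T) [T] T" "e \<in> families C \<O> \<O> [] T"
  using assms by (auto simp: skew_monoids_def)

text \<open>This is why the assignment can be injective although it records only the object part of
  \<open>T\<close>.\<close>

lemma skew_monoid_farr:
  assumes M: "(T, m, e) \<in> skew_monoids multicat" and "x \<in> obj C" "y \<in> obj C" "u \<in> arr C x y"
  shows "farr T x y u = m [x, y] [lact \<O> x y (fobj T y) u (e [y] [])]"
proof -
  note D = skew_monoidsD[OF M]
  have "e [y] [] \<in> het \<O> y (fobj T y)" using families_het[OF D(3), of "[y]" "[]"] assms by simp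
  then have "m [x, y] [lact \<O> x y (fobj T y) u (e [y] [])]
      = cmp D (fobj T x) (fobj T y) (fobj T y) (farr T x y u) (m [y, y] [e [y] []])"
    using families_single_natural_first[OF D(2), of x y y u] assms by simp
  moreover have "m [y, y] [e [y] []] = idt D (fobj T y)"
    using M skew_monoids_iff[OF D] assms by blast
  ultimately show ?thesis using functorsD[OF D(1)] assms by (simp add: D.cmp_idt)
qed

lemma inj_monoid_to_relative_monad:
  "inj_on (monoid_to_relative_monad C \<O>) (skew_monoids multicat)"
proof (rule inj_onI)
  fix M M'
  assume MM: "M \<in> skew_monoids multicat" "M' \<in> skew_monoids multicat"
    "monoid_to_relative_monad C \<O> M = monoid_to_relative_monad C \<O> M'"
  obtain T m e T' m' e' where [simp]: "M = (T, m, e)" "M' = (T', m', e')"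
    by (cases M; cases M') auto
  note M = MM(1)[simplified] and M' = MM(2)[simplified] and eq = MM(3)[simplified]
  note D = skew_monoidsD[OF M] and D' = skew_monoidsD[OF M']
  have ob: "fobj T = fobj T'" using eq by (simp add: monoid_to_relative_monad_def)
  have ee: "e [x] [] = e' [x] []" if "x \<in> obj C" for x
    using eq that by (auto simp: monoid_to_relative_monad_def dest!: fun_cong[of _ _ x])
  have mm: "m [x, y] [k] = m' [x, y] [k]" if "x \<in> obj C" "y \<in> obj C" "k \<in> het \<O> x (fobj T y)" for x y k
  proof -
    have "(\<lambda>x\<in>obj C. \<lambda>y\<in>obj C. \<lambda>k\<in>het \<O> x (fobj T y). m [x, y] [k])
      = (\<lambda>x\<in>obj C. \<lambda>y\<in>obj C. \<lambda>k\<in>het \<O> x (fobj T' y). m' [x, y] [k])"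
      using eq unfolding monoid_to_relative_monad_def prod.case prod.inject by blast
    from fun_cong[OF fun_cong[OF fun_cong[OF this]], of x y k] show ?thesis using that ob by simp
  qed
  \<comment> \<open>Equality of the functors precedes that of the multiplications, because it puts
    \<open>m\<close> and \<open>m'\<close> into families with the same domain.\<close>
  have TT: "T = T'"
  proof (rule functor_eqI[OF D(1) D'(1) ob])
    fix x y u assume *: "x \<in> obj C" "y \<in> obj C" "u \<in> arr C x y"
    then have "lact \<O> x y (fobj T y) u (e [y] []) \<in> het \<O> x (fobj T y)"
      using families_het[OF D(3), of "[y]" "[]"] functorsD[OF D(1)] by (intro lact_closed) auto
    with * show "farr T x y u = farr T' x y u"
      by (simp add: skew_monoid_farr[OF M] skew_monoid_farr[OF M'] mm ee ob)
  qed
  moreover have "m = m'"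
    by (rule families_eqI[OF D(2)]) (use D'(2) TT mm in \<open>auto simp: chain_single\<close>)
  moreover have "e = e'"
    by (rule families_eqI[OF D(3)]) (use D'(3) TT ee in auto)
  ultimately show "M = M'" by simp
qed

lemma monoid_to_relative_monad_relative_monad:
  assumes M: "(T, m, e) \<in> skew_monoids multicat"
    and img: "monoid_to_relative_monad C \<O> (T, m, e) = (T0, \<eta>, star)"
  shows "relative_monad C D \<O> T0 \<eta> star"
proof -
  note D = skew_monoidsD[OF M]
  have T0: "T0 = fobj T" and \<eta>: "\<eta> = (\<lambda>x\<in>obj C. e [x] [])"
    and star: "star = (\<lambda>x\<in>obj C. \<lambda>y\<in>obj C. \<lambda>k\<in>het \<O> x (fobj T y). m [x, y] [k])"
    using img by (auto simp: monoid_to_relative_monad_def)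
  have eh: "e [x] [] \<in> het \<O> x (fobj T x)" if "x \<in> obj C" for x
    using families_het[OF D(3), of "[x]" "[]"] that by simp
  have mh: "m [x, y] [k] \<in> arr D (fobj T x) (fobj T y)"
    if "x \<in> obj C" "y \<in> obj C" "k \<in> het \<O> x (fobj T y)" for x y k
    using families_het[OF D(2), of "[x, y]" "[k]"] that by (simp add: chain_single)
  note laws = M[unfolded skew_monoids_iff[OF D]]
  have To: "fobj T x \<in> obj D" if "x \<in> obj C" for x using functorsD(1)[OF D(1)] that .
  show ?thesis
  proof unfold_locales
    show "T0 \<in> obj C \<rightarrow>\<^sub>E obj D" using D(1) by (simp add: functors_def T0)
    show "\<eta> \<in> (\<Pi>\<^sub>E x\<in>obj C. het \<O> x (T0 x))" using eh by (simp add: \<eta> T0)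
    show "star \<in> (\<Pi>\<^sub>E x\<in>obj C. \<Pi>\<^sub>E y\<in>obj C. het \<O> x (T0 y) \<rightarrow>\<^sub>E arr D (T0 x) (T0 y))"
      using mh by (simp add: star T0)
  next
    fix x y z k l
    assume "x \<in> obj C" "y \<in> obj C" "z \<in> obj C" "k \<in> het \<O> x (T0 y)" "l \<in> het \<O> y (T0 z)"
    then show "cmp D (T0 x) (T0 y) (T0 z) (star x y k) (star y z l)
        = star x z (ract \<O> x (T0 y) (T0 z) k (star y z l))"
      using laws by (simp add: star T0 mh To ract_closed)
  qed (use laws eh in \<open>auto simp: \<eta> star T0\<close>)
qed

end

section \<open>From a relative monad to a monoid\<close>

context relative_monad
begin

definition monad_functor :: "('c, 'ca, 'd, 'da) cfunctor" where
  "monad_functor = \<lparr>fobj = T,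
     farr = (\<lambda>x\<in>obj C. \<lambda>y\<in>obj C. \<lambda>u\<in>arr C x y. star x y (lact \<O> x y (T y) u (\<eta> y)))\<rparr>"

definition monad_mult :: "'c list \<Rightarrow> 'm list \<Rightarrow> 'da" where
  "monad_mult = fam [monad_functor] (\<lambda>xs ks. star (hd xs) (last xs) (hd ks))"

definition monad_unit :: "'c list \<Rightarrow> 'm list \<Rightarrow> 'm" where
  "monad_unit = fam [] (\<lambda>xs ks. \<eta> (hd xs))"

lemma T_obj: "x \<in> obj C \<Longrightarrow> T x \<in> obj D"
  and \<eta>_het: "x \<in> obj C \<Longrightarrow> \<eta> x \<in> het \<O> x (T x)"
  and star_arr: "\<lbrakk>x \<in> obj C; y \<in> obj C; k \<in> het \<O> x (T y)\<rbrakk> \<Longrightarrow> star x y k \<in> arr D (T x) (T y)"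
  using T_closed \<eta>_closed star_closed by (auto simp: PiE_iff)

lemma fobj_monad_functor [simp]: "fobj monad_functor = T"
  by (simp add: monad_functor_def)

lemma farr_monad_functor [simp]: "\<lbrakk>x \<in> obj C; y \<in> obj C; u \<in> arr C x y\<rbrakk> \<Longrightarrow>
    farr monad_functor x y u = star x y (lact \<O> x y (T y) u (\<eta> y))"
  by (simp add: monad_functor_def)

text \<open>The action of \<open>u\<close> passes outside by \<open>lact_ract\<close>, and
  \<open>\<eta>_star\<close> finishes. Combined with \<open>star_star\<close> it shows that the
  arrow induced by \<open>u\<close>, followed by \<open>star x' z k\<close>, is the extension of
  \<open>u;k\<close>; functoriality and naturality in the first object both follow.\<close>

lemma lact_\<eta>_star:
  assumes "x \<in> obj C" "x' \<in> obj C" "z \<in> obj C" "u \<in> arr C x x'" "k \<in> het \<O> x' (T z)"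
  shows "ract \<O> x (T x') (T z) (lact \<O> x x' (T x') u (\<eta> x')) (star x' z k) = lact \<O> x x' (T z) u k"
  using assms by (simp add: lact_ract T_obj \<eta>_het star_arr \<eta>_star)

lemma monad_functor_functors: "monad_functor \<in> functors C D"
proof -
  have "star x z (lact \<O> x z (T z) (cmp C x y z u v) (\<eta> z))
      = cmp D (T x) (T y) (T z) (star x y (lact \<O> x y (T y) u (\<eta> y))) (star y z (lact \<O> y z (T z) v (\<eta> z)))"
    if "x \<in> obj C" "y \<in> obj C" "z \<in> obj C" "u \<in> arr C x y" "v \<in> arr C y z" for x y z u v
    using that by (simp add: star_star lact_\<eta>_star lact_lact lact_closed T_obj \<eta>_het)
  then show ?thesis unfolding functors_def
    using T_closed
    by (auto simp: T_obj \<eta>_het star_arr lact_closed lact_idt star_\<eta> C.idt_closed C.cmp_closed)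
      (auto simp: monad_functor_def T_obj \<eta>_het star_arr lact_closed)
qed

text \<open>Naturality in the first object comes from \<open>star_star\<close> with
  \<open>lact_\<eta>_star\<close>. Naturality in the last one is \<open>star_star\<close> read
  backwards, since the arrow part of the functor is itself a value of \<open>star\<close>.\<close>

lemma monad_mult_families: "monad_mult \<in> families C \<O> (companion D monad_functor) [monad_functor] monad_functor"
  unfolding monad_mult_def
proof (rule fam_single_familiesI[OF monad_functor_functors])
  fix x x' z u k
  assume "x \<in> obj C" "x' \<in> obj C" "z \<in> obj C" "u \<in> arr C x x'" "k \<in> het \<O> x' (fobj monad_functor z)"
  then show "lact (companion D monad_functor) x x' (fobj monad_functor z) u (star x' z k)
      = star x z (lact \<O> x x' (fobj monad_functor z) u k)"
    by (simp add: star_star lact_\<eta>_star lact_closed T_obj \<eta>_het)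
qed (simp_all add: star_arr star_star lact_closed T_obj \<eta>_het)

text \<open>Naturality is \<open>\<eta>_star\<close> at \<open>u;\<eta>\<close>, whose extension is
  the arrow part at \<open>u\<close>.\<close>

lemma monad_unit_families: "monad_unit \<in> families C \<O> \<O> [] monad_functor"
  unfolding monad_unit_def
  by (rule fam_Nil_familiesI) (simp_all add: \<eta>_het \<eta>_star lact_closed T_obj)

lemma monad_mult_apply:
  "\<lbrakk>x \<in> obj C; y \<in> obj C; k \<in> het \<O> x (T y)\<rbrakk> \<Longrightarrow> monad_mult [x, y] [k] = star x y k"
  by (simp add: monad_mult_def fam_apply chain_single)

lemma monad_unit_apply: "x \<in> obj C \<Longrightarrow> monad_unit [x] [] = \<eta> x"
  by (simp add: monad_unit_def fam_apply)

lemma monad_skew_monoid: "(monad_functor, monad_mult, monad_unit) \<in> skew_monoids multicat"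
  unfolding skew_monoids_iff[OF monad_functor_functors monad_mult_families monad_unit_families]
  by (simp add: monad_mult_apply monad_unit_apply \<eta>_het \<eta>_star star_\<eta> star_star ract_closed star_arr T_obj)

lemma monoid_to_relative_monad_monad:
  "monoid_to_relative_monad C \<O> (monad_functor, monad_mult, monad_unit) = (T, \<eta>, star)"
proof -
  have "(\<lambda>x\<in>obj C. monad_unit [x] []) = (\<lambda>x\<in>obj C. \<eta> x)"
    by (rule restrict_ext) (simp add: monad_unit_apply)
  also have "\<dots> = \<eta>" using \<eta>_closed by (simp add: PiE_restrict)
  finally have 1: "(\<lambda>x\<in>obj C. monad_unit [x] []) = \<eta>" .
  have "(\<lambda>x\<in>obj C. \<lambda>y\<in>obj C. \<lambda>k\<in>het \<O> x (T y). monad_mult [x, y] [k]) x y k = star x y k" for x y k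
    using star_closed
    by (cases "x \<in> obj C"; cases "y \<in> obj C"; cases "k \<in> het \<O> x (T y)")
      (auto simp: monad_mult_apply PiE_iff extensional_def)
  then have "(\<lambda>x\<in>obj C. \<lambda>y\<in>obj C. \<lambda>k\<in>het \<O> x (T y). monad_mult [x, y] [k]) = star" by blast
  with 1 show ?thesis by (simp add: monoid_to_relative_monad_def)
qed

end

theorem theorem2:
  fixes C :: "('c, 'ca) category" and D :: "('d, 'da) category"
    and \<O> :: "('c, 'ca, 'd, 'da, 'm) bimodule"
  assumes "bimodule C D \<O>"
  shows "left_skew_multicategory (bimodule_multicat C D \<O>) \<and>
    bij_betw (monoid_to_relative_monad C \<O>)
      (skew_monoids (bimodule_multicat C D \<O>))
      {(T, \<eta>, star). relative_monad C D \<O> T \<eta> star}"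
proof
  interpret bimodule C D \<O> by fact
  show "left_skew_multicategory (bimodule_multicat C D \<O>)"
    by (rule left_skew_multicategory_multicat)
  have "monoid_to_relative_monad C \<O> ` skew_monoids (bimodule_multicat C D \<O>)
      = {(T, \<eta>, star). relative_monad C D \<O> T \<eta> star}"
  proof (intro equalityI subsetI)
    fix M assume "M \<in> monoid_to_relative_monad C \<O> ` skew_monoids (bimodule_multicat C D \<O>)"
    then show "M \<in> {(T, \<eta>, star). relative_monad C D \<O> T \<eta> star}"
      by (cases M) (auto dest!: monoid_to_relative_monad_relative_monad[OF _ sym])
  next
    fix M assume "M \<in> {(T, \<eta>, star). relative_monad C D \<O> T \<eta> star}"
    then obtain T \<eta> star where M: "M = (T, \<eta>, star)" and "relative_monad C D \<O> T \<eta> star" by auto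
    then interpret relative_monad C D \<O> T \<eta> star by simp
    show "M \<in> monoid_to_relative_monad C \<O> ` skew_monoids (bimodule_multicat C D \<O>)"
      using monad_skew_monoid monoid_to_relative_monad_monad M by (metis imageI)
  qed
  then show "bij_betw (monoid_to_relative_monad C \<O>) (skew_monoids (bimodule_multicat C D \<O>))
      {(T, \<eta>, star). relative_monad C D \<O> T \<eta> star}"
    using inj_monoid_to_relative_monad by (simp add: bij_betw_def)
qed

end
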